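(* Let $K$ be a field, $r\ge 1$, $R=K[t_1,\dots,t_r]$, and let $I\subseteq R$ be a non-zero monomial ideal. Let $s$ be the number of minimal monomial generators of $I$ and let $d$ be the maximal total degree of these generators. Put $$B=\max\Big\{d(rs+s+d)(\sqrt r)^{\,r+1}(\sqrt2\,d)^{(r+1)(s-1)},\ \ s(s+r)^4s^{r+2}d^2(2d^2)^{s^2-s+1}\Big\}.$$ Then for all integers $n\ge \lceil B\rceil$, $$\operatorname{Ass}_R(I^n/I^{n+1})=\operatorname{Ass}_R(I^{\lceil B\rceil}/I^{\lceil B\rceil+1}).$$
   Context: $\operatorname{Ass}_R(M)$ denotes the set of associated primes of an $R$-module $M$; $I^0=R$. *)

theory Defs
  imports
    "HOL-Algebra.Algebra"
    "HOL-Algebra.Algebraic_Closure_Type"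
    "HOL-Library.Cardinality"
    "HOL-Library.Poly_Mapping"
begin

text \<open>
  A polynomial with coefficients in \<open>'k\<close> and variables indexed by \<open>'n\<close> is a finitely supported
  map from exponent vectors to coefficients. The multiplication supplied by the theory
  \<open>Poly_Mapping\<close> is convolution, so for finite \<open>'n\<close> this is the polynomial ring over \<open>'k\<close>
  in \<open>CARD('n)\<close> variables.
\<close>

type_synonym ('n, 'k) mpolynomial = "('n \<Rightarrow>\<^sub>0 nat) \<Rightarrow>\<^sub>0 'k"

abbreviation mpoly_ring :: "('n, 'k::comm_ring_1) mpolynomial ring" where
  "mpoly_ring \<equiv> ring_of_type_algebra"

definition monomials :: "('n, 'k::comm_ring_1) mpolynomial set" where
  "monomials = range (\<lambda>e. Poly_Mapping.single e 1)"

text \<open>Meant for nonzero \<open>p\<close>.\<close>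

definition total_degree :: "('n::finite, 'k::comm_ring_1) mpolynomial \<Rightarrow> nat" where
  "total_degree p = Max ((\<lambda>e. \<Sum>i\<in>UNIV. Poly_Mapping.lookup e i) ` Poly_Mapping.keys p)"

definition monomial_ideal :: "('n, 'k::comm_ring_1) mpolynomial set \<Rightarrow> bool" where
  "monomial_ideal I \<longleftrightarrow> (\<exists>E \<subseteq> monomials. I = Idl\<^bsub>mpoly_ring\<^esub> E)"

definition minimal_monomial_generators ::
  "('n, 'k::comm_ring_1) mpolynomial set \<Rightarrow> ('n, 'k) mpolynomial set \<Rightarrow> bool" where
  "minimal_monomial_generators G I \<longleftrightarrow>
     G \<subseteq> monomials \<and> Idl\<^bsub>mpoly_ring\<^esub> G = I \<and> (\<forall>H. H \<subset> G \<longrightarrow> Idl\<^bsub>mpoly_ring\<^esub> H \<noteq> I)"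

text \<open>
  The record type of modules extends that of rings; the fields \<open>mult\<close> and \<open>one\<close> play no role
  in the locale \<open>module\<close>.
\<close>

definition ideal_module :: "('a, 'c) ring_scheme \<Rightarrow> 'a set \<Rightarrow> ('a, 'a) module" where
  "ideal_module R I =
     \<lparr>carrier = I, monoid.mult = undefined, one = undefined, ring.zero = \<zero>\<^bsub>R\<^esub>, add = add R, module.smult = monoid.mult R\<rparr>"

definition quotient_module ::
  "('a, 'b, 'c) module_scheme \<Rightarrow> 'b set \<Rightarrow> ('a, 'b set) module" where
  "quotient_module M N =
     \<lparr>carrier = a_rcosets\<^bsub>M\<^esub> N, monoid.mult = undefined, one = undefined, ring.zero = N, add = set_add M,
      module.smult = (\<lambda>a C. \<Union>x\<in>C. N +>\<^bsub>M\<^esub> (a \<odot>\<^bsub>M\<^esub> x))\<rparr>"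

definition annihilator :: "('a, 'c) ring_scheme \<Rightarrow> ('a, 'b, 'd) module_scheme \<Rightarrow> 'b \<Rightarrow> 'a set" where
  "annihilator R M x = {a \<in> carrier R. a \<odot>\<^bsub>M\<^esub> x = \<zero>\<^bsub>M\<^esub>}"

definition associated_primes ::
  "('a, 'c) ring_scheme \<Rightarrow> ('a, 'b, 'd) module_scheme \<Rightarrow> 'a set set" where
  "associated_primes R M = {P. primeideal P R \<and> (\<exists>x \<in> carrier M. P = annihilator R M x)}"

lemma module_ideal_module:
  assumes "cring R" "ideal I R"
  shows "module R (ideal_module R I)"
proof -
  interpret R: cring R by fact
  interpret I: ideal I R by fact
  have "abelian_group (ideal_module R I)"
  proof (rule abelian_groupI)
    fix x assume "x \<in> carrier (ideal_module R I)"
    then show "\<exists>y\<in>carrier (ideal_module R I). y \<oplus>\<^bsub>ideal_module R I\<^esub> x = \<zero>\<^bsub>ideal_module R I\<^esub>"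
      by (intro bexI[of _ "\<ominus>\<^bsub>R\<^esub> x"]) (auto simp: ideal_module_def R.l_neg)
  qed (auto simp: ideal_module_def R.a_ac)
  then show ?thesis
    using assms(1)
    by (intro moduleI)
       (auto simp: ideal_module_def I.I_l_closed R.l_distr R.r_distr R.m_assoc)
qed

lemma submodule_ideal_module:
  assumes "cring R" "ideal I R" "ideal J R" "J \<subseteq> I"
  shows "submodule J R (ideal_module R I)"
proof -
  interpret R: cring R by fact
  interpret M: module R "ideal_module R I"
    using assms by (intro module_ideal_module)
  interpret I: ideal I R by fact
  interpret J: ideal J R by fact
  have inv: "\<ominus>\<^bsub>ideal_module R I\<^esub> a = \<ominus>\<^bsub>R\<^esub> a" if "a \<in> J" for a
  proof (rule M.minus_equality)
    show "\<ominus>\<^bsub>R\<^esub> a \<oplus>\<^bsub>ideal_module R I\<^esub> a = \<zero>\<^bsub>ideal_module R I\<^esub>"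
      using that by (auto simp: ideal_module_def R.l_neg)
  qed (use that assms(4) in \<open>auto simp: ideal_module_def\<close>)
  show ?thesis
  proof (rule M.submoduleI)
    show "\<ominus>\<^bsub>ideal_module R I\<^esub> a \<in> J" if "a \<in> J" for a
      using inv[OF that] that by simp
  qed (use assms(4) in \<open>auto simp: ideal_module_def J.I_l_closed\<close>)
qed

lemma quotient_module_smult_coset:
  assumes "module R M" "submodule N R M" "a \<in> carrier R" "x \<in> carrier M"
  shows "a \<odot>\<^bsub>quotient_module M N\<^esub> (N +>\<^bsub>M\<^esub> x) = N +>\<^bsub>M\<^esub> (a \<odot>\<^bsub>M\<^esub> x)"
proof -
  interpret M: module R M by fact
  interpret N: submodule N R M by fact
  interpret A: abelian_subgroup N M
    by (rule abelian_subgroupI3)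
       (auto intro!: additive_subgroup.intro N.subgroup_axioms M.abelian_group_axioms)
  have "N +>\<^bsub>M\<^esub> (a \<odot>\<^bsub>M\<^esub> y) = N +>\<^bsub>M\<^esub> (a \<odot>\<^bsub>M\<^esub> x)" if y: "y \<in> N +>\<^bsub>M\<^esub> x" for y
  proof -
    from y obtain h where h: "h \<in> N" "y = h \<oplus>\<^bsub>M\<^esub> x"
      by (auto simp: a_r_coset_def')
    have "a \<odot>\<^bsub>M\<^esub> y = a \<odot>\<^bsub>M\<^esub> h \<oplus>\<^bsub>M\<^esub> a \<odot>\<^bsub>M\<^esub> x"
      using h assms(3,4) A.a_Hcarr by (simp add: M.smult_r_distr)
    moreover have "a \<odot>\<^bsub>M\<^esub> h \<in> N" using h assms(3) by auto
    ultimately have "a \<odot>\<^bsub>M\<^esub> y \<in> N +>\<^bsub>M\<^esub> (a \<odot>\<^bsub>M\<^esub> x)"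
      by (auto simp: a_r_coset_def')
    then show ?thesis
      using M.a_repr_independence[OF _ _ N.subgroup_axioms] M.smult_closed assms(3,4) by metis
  qed
  moreover have "N +>\<^bsub>M\<^esub> x \<noteq> {}"
    using A.a_rcos_self[OF assms(4)] by blast
  ultimately show ?thesis
    by (auto simp: quotient_module_def)
qed

lemma module_quotient_module:
  assumes "module R M" "submodule N R M"
  shows "module R (quotient_module M N)"
proof -
  interpret M: module R M by fact
  interpret N: submodule N R M by fact
  interpret A: abelian_subgroup N M
    by (rule abelian_subgroupI3)
       (auto intro!: additive_subgroup.intro N.subgroup_axioms M.abelian_group_axioms)
  let ?Q = "quotient_module M N"
  note sm = quotient_module_smult_coset[OF assms]
  have car: "C \<in> carrier ?Q \<longleftrightarrow> (\<exists>x\<in>carrier M. C = N +>\<^bsub>M\<^esub> x)" for C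
    by (auto simp: quotient_module_def A_RCOSETS_def')
  have add: "(N +>\<^bsub>M\<^esub> x) \<oplus>\<^bsub>?Q\<^esub> (N +>\<^bsub>M\<^esub> y) = N +>\<^bsub>M\<^esub> (x \<oplus>\<^bsub>M\<^esub> y)"
    if "x \<in> carrier M" "y \<in> carrier M" for x y
    using A.a_rcos_sum[OF that] by (simp add: quotient_module_def)
  have zero: "\<zero>\<^bsub>?Q\<^esub> = N +>\<^bsub>M\<^esub> \<zero>\<^bsub>M\<^esub>"
    using M.a_coset_add_zero[OF A.a_subset] by (simp add: quotient_module_def)
  have "abelian_group ?Q"
  proof (rule abelian_groupI)
    fix C assume "C \<in> carrier ?Q"
    then obtain x where x: "x \<in> carrier M" "C = N +>\<^bsub>M\<^esub> x" by (auto simp: car)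
    then show "\<exists>D\<in>carrier ?Q. D \<oplus>\<^bsub>?Q\<^esub> C = \<zero>\<^bsub>?Q\<^esub>"
      by (intro bexI[of _ "N +>\<^bsub>M\<^esub> (\<ominus>\<^bsub>M\<^esub> x)"]) (auto simp: car add zero M.l_neg)
  qed (auto simp: car add zero M.a_ac)
  then show ?thesis
    by (intro moduleI M.is_cring)
       (auto simp: car add sm M.smult_l_distr M.smult_r_distr M.smult_assoc1)
qed

end

theory Submission
  imports Defs
begin

text \<open>
  \<^bold>\<open>Reduction to integer programs.\<close> Let \<open>E\<close> be the set of exponent vectors of the minimal
  generators of \<open>I\<close>, and let \<open>s\<close> be its size. All the ideals \<open>I\<^sup>n\<close> are spanned by
  monomials, and \<open>x\<^sup>b\<close> lies in \<open>I\<^sup>n\<close> iff some vector \<open>u\<close> of natural numbers indexed by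
  \<open>E\<close>, with entries summing to \<open>n\<close>, satisfies \<open>\<Sum>g. u g * g \<le> b\<close> coordinatewise. An
  associated prime of \<open>I\<^sup>n / I\<^sup>n\<^sup>+\<^sup>1\<close> is generated by a set \<open>F\<close> of variables and is the
  annihilator of a monomial. After setting the variables outside \<open>F\<close> to \<open>1\<close> this says
  that some \<open>b\<close> is \<^emph>\<open>critical of level\<close> \<open>n\<close>: looking only at the coordinates in \<open>F\<close>,
  the largest total of a \<open>u\<close> that fits below \<open>b\<close> is \<open>n\<close>, and it grows as soon as any
  coordinate of \<open>b\<close> in \<open>F\<close> is raised by one (\<open>associated_primes_power_iff\<close>).

  \<^bold>\<open>Proximity.\<close> Suppose that \<open>u\<close> fits below \<open>b\<close>, and that some vector whose total is larger
  by \<open>1\<close> or \<open>2\<close> fits below a slightly larger bound. Then such a vector can be found that is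
  nowhere smaller than \<open>u\<close> by more than a constant \<open>c = (s + |F| + 2) ((s + 2) d)\<^sup>s\<close>
  independent of \<open>n\<close> (\<open>nearby_solution\<close>). To see this, write the difference of the two
  vectors as a nonnegative combination of short integer vectors that do not overshoot in any
  of the constraints. A summand that preserves the total can be cancelled as long as its
  coefficient is at least \<open>1\<close>; after all such cancellations every coefficient is at most
  \<open>1\<close>, while the number and the length of the summands are bounded. Short vectors come from
  the pigeonhole principle.

  \<^bold>\<open>Moving between levels.\<close> Suppose \<open>n > s c\<close>, and let \<open>b\<close> be critical of level \<open>n\<close>, as
  witnessed by \<open>u\<close>. Some entry \<open>u g\<close> exceeds \<open>c\<close>. By proximity, each of the finitely many
  competing vectors that matter may be assumed to contain \<open>g\<close>, so one copy of \<open>g\<close> can be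
  removed from all of them. Hence \<open>b + g\<close> is critical of level \<open>n + 1\<close> and \<open>b - g\<close> is
  critical of level \<open>n - 1\<close> (\<open>critical_up\<close>, \<open>critical_down\<close>). So the sets of associated
  primes agree for all \<open>n > s c\<close>, and \<open>s c\<close> is smaller than the second of the two numbers
  whose maximum is \<open>B\<close>. For \<open>d = 0\<close> the ideal is the whole ring and there are no critical
  points at all.
\<close>

section \<open>Short integer vectors in conformal position\<close>

definition lin :: "'j set \<Rightarrow> ('j \<Rightarrow> int) \<Rightarrow> ('j \<Rightarrow> int) \<Rightarrow> int" where
  "lin J a x = (\<Sum>j\<in>J. a j * x j)"

lemma lin_diff: "lin J a (\<lambda>j. x j - y j) = lin J a x - lin J a y"
  by (simp add: lin_def algebra_simps sum_subtractf)

lemma lin_scale: "lin J a (\<lambda>j. k * x j) = k * lin J a x"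
  by (simp add: lin_def algebra_simps sum_distrib_left)

lemma lin_combination:
  "lin J a (\<lambda>j. k * x j - m * y j) = k * lin J a x - m * lin J a y"
  by (simp add: lin_diff lin_scale)

text \<open>
  Coordinates are linear forms too; including them among the forms lets one notion of sign
  compatibility control both the entries of a vector and its values on the constraints.
\<close>

definition unit_form :: "'j \<Rightarrow> 'j \<Rightarrow> int" where
  "unit_form j i = (if i = j then 1 else 0)"

lemma lin_unit_form: "finite J \<Longrightarrow> j \<in> J \<Longrightarrow> lin J (unit_form j) x = x j"
  by (subst lin_def, subst sum.remove[of J j]) (auto simp: unit_form_def intro!: sum.neutral)

text \<open>
  A form of Siegel's lemma. On a box with side \<open>H = c ^ card K\<close> each form takes at most
  \<open>c * H + 1\<close> values, so there are fewer value tuples than points in the box. Two points with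
  equal values differ by a short kernel vector.
\<close>

lemma small_kernel_vector:
  fixes a :: "'k \<Rightarrow> 'j \<Rightarrow> int" and c :: nat
  assumes fin: "finite J" "finite K" and less: "card K < card J" and c: "1 \<le> c"
    and norm: "\<And>k. k \<in> K \<Longrightarrow> (\<Sum>j\<in>J. \<bar>a k j\<bar>) \<le> int c"
  shows "\<exists>v. (\<exists>j\<in>J. v j \<noteq> 0) \<and> (\<forall>k\<in>K. lin J (a k) v = 0)
    \<and> (\<forall>j\<in>J. \<bar>v j\<bar> \<le> int c ^ card K)"
proof -
  define H where "H = c ^ card K"
  define D where "D = J \<rightarrow>\<^sub>E {0..int H}"
  define lo hi where "lo k = (\<Sum>j\<in>J. min 0 (a k j) * int H)"
    and "hi k = (\<Sum>j\<in>J. max 0 (a k j) * int H)" for k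
  define C where "C = (\<Pi>\<^sub>E k\<in>K. {lo k..hi k})"
  define f where "f v = (\<lambda>k\<in>K. lin J (a k) v)" for v
  have "f v \<in> C" if v: "v \<in> D" for v
  proof -
    have "lo k \<le> lin J (a k) v \<and> lin J (a k) v \<le> hi k" if "k \<in> K" for k
    proof -
      have "min 0 (a k j) * int H \<le> a k j * v j \<and> a k j * v j \<le> max 0 (a k j) * int H" if "j \<in> J" for j
      proof -
        have vj: "0 \<le> v j" "v j \<le> int H" using v that by (auto simp: D_def PiE_def Pi_def)
        then show ?thesis
          by (cases "0 \<le> a k j")
            (auto simp: mult_left_mono mult_left_mono_neg mult_nonpos_nonneg)
      qed
      then show ?thesis unfolding lo_def hi_def lin_def by (auto intro!: sum_mono)
    qed
    then show ?thesis by (auto simp: f_def C_def)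
  qed
  then have sub: "f ` D \<subseteq> C" by auto
  have size: "nat (hi k - lo k + 1) \<le> c * H + 1" if "k \<in> K" for k
  proof -
    have "hi k - lo k = (\<Sum>j\<in>J. \<bar>a k j\<bar>) * int H"
      unfolding hi_def lo_def sum_subtractf[symmetric] sum_distrib_right
      by (intro sum.cong) (auto simp: max_def min_def)
    also have "\<dots> \<le> int c * int H" using norm[OF that] by (intro mult_right_mono) auto
    finally show ?thesis by (simp add: nat_le_iff)
  qed
  have "card C = (\<Prod>k\<in>K. nat (hi k - lo k + 1))"
    unfolding C_def using fin by (simp add: card_PiE)
  also have "\<dots> \<le> (\<Prod>k\<in>K. c * H + 1)" using size by (intro prod_mono) auto
  also have "\<dots> = (c * H + 1) ^ card K" by simp
  also have "\<dots> \<le> (c * (H + 1)) ^ card K" using c by (intro power_mono) auto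
  also have "\<dots> = H * (H + 1) ^ card K" by (simp only: power_mult_distrib H_def)
  also have "\<dots> < (H + 1) ^ Suc (card K)" by simp
  also have "\<dots> \<le> (H + 1) ^ card J" using less by (intro power_increasing) auto
  also have "\<dots> = card D" unfolding D_def using fin by (simp add: card_PiE nat_add_distrib)
  finally have "card C < card D" .
  moreover have "finite C" unfolding C_def using fin by (intro finite_PiE) auto
  ultimately have "\<not> inj_on f D" using sub card_inj_on_le by (metis leD)
  then obtain v w where vw: "v \<in> D" "w \<in> D" "f v = f w" "v \<noteq> w" by (auto simp: inj_on_def)
  then obtain j where j: "v j \<noteq> w j" by blast
  have "j \<in> J" using vw(1,2) j unfolding D_def by (metis PiE_arb)
  moreover have "lin J (a k) (\<lambda>j. v j - w j) = 0" if "k \<in> K" for k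
    using fun_cong[OF vw(3), of k] that by (simp add: f_def lin_diff)
  moreover have "\<bar>v j - w j\<bar> \<le> int H" if "j \<in> J" for j
  proof -
    have "v j \<in> {0..int H}" "w j \<in> {0..int H}"
      using PiE_mem[OF vw(1)[unfolded D_def] that] PiE_mem[OF vw(2)[unfolded D_def] that] .
    then show ?thesis by auto
  qed
  ultimately show ?thesis
    using j by (intro exI[of _ "\<lambda>j. v j - w j"]) (auto simp: H_def)
qed

text \<open>
  This is the rank bound behind the exponent in the length of short vectors: forms with a
  common nonzero zero \<open>x\<close> have rank less than the number of coordinates. A minimal family
  with the same kernel has for each member a vector killed by all the other members but not
  by that one. These vectors together with \<open>x\<close> are linearly independent, so there cannot be
  more of them than coordinates; a dependency is again provided by the pigeonhole principle.
\<close>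

lemma kernel_cut_by_few_forms:
  fixes Z :: "('j \<Rightarrow> int) set"
  assumes fin: "finite J" "finite Z" and x: "\<forall>\<phi>\<in>Z. lin J \<phi> x = 0" "\<exists>j\<in>J. x j \<noteq> 0"
  shows "\<exists>K\<subseteq>Z. card K < card J \<and>
    (\<forall>v. (\<forall>\<phi>\<in>K. lin J \<phi> v = 0) \<longrightarrow> (\<forall>\<phi>\<in>Z. lin J \<phi> v = 0))"
proof -
  define cuts where "cuts K \<longleftrightarrow> K \<subseteq> Z \<and>
    (\<forall>v. (\<forall>\<phi>\<in>K. lin J \<phi> v = 0) \<longrightarrow> (\<forall>\<phi>\<in>Z. lin J \<phi> v = 0))" for K
  have "cuts Z" by (simp add: cuts_def)
  then obtain K where K: "cuts K" and least: "\<And>L. cuts L \<Longrightarrow> card K \<le> card L"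
    using ex_has_least_nat[of cuts Z card] by blast
  have finK: "finite K" using K fin(2) finite_subset by (auto simp: cuts_def)
  have "\<exists>y. (\<forall>\<psi>\<in>K - {\<phi>}. lin J \<psi> y = 0) \<and> lin J \<phi> y \<noteq> 0" if "\<phi> \<in> K" for \<phi>
  proof -
    have "\<not> cuts (K - {\<phi>})"
      using least[of "K - {\<phi>}"] card_Diff1_less[OF finK that] by auto
    moreover have "K - {\<phi>} \<subseteq> Z" using K by (auto simp: cuts_def)
    ultimately obtain y where y: "\<forall>\<psi>\<in>K - {\<phi>}. lin J \<psi> y = 0" "\<not> (\<forall>\<psi>\<in>Z. lin J \<psi> y = 0)"
      by (auto simp: cuts_def)
    then have "lin J \<phi> y \<noteq> 0" using K unfolding cuts_def by (metis Diff_iff singletonD)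
    then show ?thesis using y by blast
  qed
  then obtain y where y: "\<And>\<phi> \<psi>. \<phi> \<in> K \<Longrightarrow> \<psi> \<in> K - {\<phi>} \<Longrightarrow> lin J \<psi> (y \<phi>) = 0"
    "\<And>\<phi>. \<phi> \<in> K \<Longrightarrow> lin J \<phi> (y \<phi>) \<noteq> 0"
    by metis
  have "card K < card J"
  proof (rule ccontr)
    assume "\<not> card K < card J"
    \<comment> \<open>The index None stands for x, and Some \<phi> for the vector dual to \<phi>.\<close>
    define U where "U = insert None (Some ` K)"
    define z where "z u = (case u of None \<Rightarrow> x | Some \<phi> \<Rightarrow> y \<phi>)" for u
    define c where "c = 1 + nat (\<Sum>j\<in>J. \<Sum>u\<in>U. \<bar>z u j\<bar>)"
    have finU: "finite U" using finK by (simp add: U_def)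
    have "card U = Suc (card K)"
      unfolding U_def using finK by (subst card_insert_disjoint) (auto simp: card_image)
    then have "card J < card U" using \<open>\<not> card K < card J\<close> by simp
    moreover have "(\<Sum>u\<in>U. \<bar>z u j\<bar>) \<le> int c" if "j \<in> J" for j
    proof -
      have "(\<Sum>u\<in>U. \<bar>z u j\<bar>) \<le> (\<Sum>j\<in>J. \<Sum>u\<in>U. \<bar>z u j\<bar>)"
        using fin(1) that by (intro member_le_sum[where f = "\<lambda>j. \<Sum>u\<in>U. \<bar>z u j\<bar>"]) (auto intro: sum_nonneg)
      then show ?thesis by (simp add: c_def)
    qed
    ultimately obtain \<mu> where \<mu>: "\<exists>u\<in>U. \<mu> u \<noteq> 0"
      "\<forall>j\<in>J. lin U (\<lambda>u. z u j) \<mu> = 0"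
      using small_kernel_vector[of U J c "\<lambda>j u. z u j"] fin(1) finU by (auto simp: c_def)
    have comb: "(\<Sum>u\<in>U. \<mu> u * lin J \<psi> (z u)) = 0" for \<psi>
    proof -
      have "(\<Sum>u\<in>U. \<mu> u * lin J \<psi> (z u)) = (\<Sum>j\<in>J. \<psi> j * lin U (\<lambda>u. z u j) \<mu>)"
        unfolding lin_def sum_distrib_left by (subst sum.swap) (simp add: mult_ac)
      then show ?thesis using \<mu>(2) by simp
    qed
    have zero: "\<mu> (Some \<phi>) = 0" if \<phi>: "\<phi> \<in> K" for \<phi>
    proof -
      have "lin J \<phi> (z u) = 0" if u: "u \<in> U - {Some \<phi>}" for u
      proof (cases u)
        case None
        then show ?thesis using \<phi> x(1) K by (auto simp: z_def cuts_def)
      next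
        case (Some \<psi>)
        then have "\<psi> \<in> K" "\<psi> \<noteq> \<phi>" using u by (auto simp: U_def)
        then show ?thesis using y(1)[of \<psi> \<phi>] \<phi> Some by (simp add: z_def)
      qed
      then have "(\<Sum>u\<in>U. \<mu> u * lin J \<phi> (z u)) = \<mu> (Some \<phi>) * lin J \<phi> (z (Some \<phi>))"
        using finU \<phi> by (subst sum.remove[of _ "Some \<phi>"]) (auto simp: U_def)
      then show ?thesis using comb[of \<phi>] y(2)[OF \<phi>] by (simp add: z_def)
    qed
    then have none: "\<mu> None \<noteq> 0" using \<mu>(1) by (auto simp: U_def)
    obtain j where j: "j \<in> J" "x j \<noteq> 0" using x(2) by blast
    have "(\<Sum>u\<in>Some ` K. z u j * \<mu> u) = 0" using zero by (intro sum.neutral) auto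
    then have "(\<Sum>u\<in>U. z u j * \<mu> u) = x j * \<mu> None"
      unfolding U_def using finK by (subst sum.insert) (auto simp: z_def)
    then show False using \<mu>(2) j none by (auto simp: lin_def)
  qed
  then show ?thesis using K by (auto simp: cuts_def)
qed

text \<open>
  A vanishing first argument is compatible with both signs, whereas a vanishing second one
  forces the first to vanish: passing to a compatible vector keeps the zeros.
\<close>

definition sign_compatible :: "int \<Rightarrow> int \<Rightarrow> bool" where
  "sign_compatible a b \<longleftrightarrow> a = 0 \<or> sgn a = sgn b"

definition between :: "int \<Rightarrow> int \<Rightarrow> bool" where
  "between a b \<longleftrightarrow> sign_compatible a b \<and> \<bar>a\<bar> \<le> \<bar>b\<bar>"

lemma between_trans: "between a b \<Longrightarrow> between b c \<Longrightarrow> between a c"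
  by (auto simp: between_def sign_compatible_def)

lemma sign_compatible_trans: "sign_compatible a b \<Longrightarrow> sign_compatible b c \<Longrightarrow> sign_compatible a c"
  by (auto simp: sign_compatible_def sgn_0_0)

text \<open>
  The values of a form on \<open>q * x\<close> shrink towards zero, without crossing it, when \<open>p\<close> copies
  of a compatible vector are subtracted and \<open>p / q\<close> is at most the ratio of the values.
\<close>

lemma between_combination:
  assumes "sign_compatible v x" "p * \<bar>v\<bar> \<le> q * \<bar>x\<bar>" "0 \<le> p" "0 < q"
  shows "between (q * x - p * v) (q * x)"
proof (cases "v = 0")
  case True
  then show ?thesis using assms by (auto simp: between_def sign_compatible_def)
next
  case False
  then consider "0 < x" "0 < v" | "x < 0" "v < 0"
    using assms(1) by (auto simp: sign_compatible_def sgn_if split: if_splits)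
  then show ?thesis
  proof cases
    case 1
    then have "0 < q * x" "0 \<le> p * v" "p * v \<le> q * x" using assms by auto
    then show ?thesis by (auto simp: between_def sign_compatible_def sgn_if)
  next
    case 2
    then have "q * x < 0" "p * v \<le> 0" "q * x \<le> p * v"
      using assms by (auto simp: mult_less_0_iff mult_le_0_iff)
    then show ?thesis by (auto simp: between_def sign_compatible_def sgn_if)
  qed
qed

lemma between_scale_iff: "0 < q \<Longrightarrow> between (q * a) (q * b) \<longleftrightarrow> between a b"
  by (auto simp: between_def sign_compatible_def sgn_mult abs_mult)

locale integer_forms =
  fixes J :: "'j set" and \<Phi> :: "('j \<Rightarrow> int) set" and c :: nat
  assumes finite_J: "finite J" and finite_\<Phi>: "finite \<Phi>" and c_pos: "1 \<le> c"
    and unit_forms: "\<And>j. j \<in> J \<Longrightarrow> unit_form j \<in> \<Phi>"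
    and norm: "\<And>\<phi>. \<phi> \<in> \<Phi> \<Longrightarrow> (\<Sum>j\<in>J. \<bar>\<phi> j\<bar>) \<le> int c"
begin

definition height :: int where "height = int c ^ (card J - 1)"

abbreviation nonzero :: "('j \<Rightarrow> int) \<Rightarrow> bool" where
  "nonzero x \<equiv> \<exists>j\<in>J. x j \<noteq> 0"

definition conformal :: "('j \<Rightarrow> int) \<Rightarrow> ('j \<Rightarrow> int) \<Rightarrow> bool" where
  "conformal v x \<longleftrightarrow> (\<forall>\<phi>\<in>\<Phi>. sign_compatible (lin J \<phi> v) (lin J \<phi> x))"

text \<open>
  The form that is the first to vanish when growing real multiples of \<open>v\<close> are subtracted
  from \<open>x\<close>. Its ratio is the largest multiple that can be subtracted conformally.
\<close>

lemma smallest_ratio: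
  assumes "conformal v x" "nonzero v"
  obtains \<phi> where "\<phi> \<in> \<Phi>" "lin J \<phi> v \<noteq> 0" "lin J \<phi> x \<noteq> 0"
    "\<And>\<psi>. \<psi> \<in> \<Phi> \<Longrightarrow> \<bar>lin J \<phi> x\<bar> * \<bar>lin J \<psi> v\<bar> \<le> \<bar>lin J \<phi> v\<bar> * \<bar>lin J \<psi> x\<bar>"
proof -
  define L where "L = {\<phi> \<in> \<Phi>. lin J \<phi> v \<noteq> 0}"
  define ratio where "ratio \<phi> = real_of_int \<bar>lin J \<phi> x\<bar> / real_of_int \<bar>lin J \<phi> v\<bar>" for \<phi>
  obtain j where "j \<in> J" "v j \<noteq> 0" using assms(2) by blast
  then have "unit_form j \<in> L" using finite_J by (simp add: L_def unit_forms lin_unit_form)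
  then have L: "finite L" "L \<noteq> {}" using finite_\<Phi> by (auto simp: L_def)
  define \<phi> where "\<phi> = arg_min_on ratio L"
  have \<phi>: "\<phi> \<in> L" "\<And>\<psi>. \<psi> \<in> L \<Longrightarrow> ratio \<phi> \<le> ratio \<psi>"
    using arg_min_if_finite(1)[OF L] arg_min_least[OF L] by (simp_all add: \<phi>_def)
  have le: "\<bar>lin J \<phi> x\<bar> * \<bar>lin J \<psi> v\<bar> \<le> \<bar>lin J \<phi> v\<bar> * \<bar>lin J \<psi> x\<bar>" if "\<psi> \<in> \<Phi>" for \<psi>
  proof (cases "lin J \<psi> v = 0")
    case False
    then have "ratio \<phi> \<le> ratio \<psi>" using \<phi> that by (auto simp: L_def)
    then have "real_of_int (\<bar>lin J \<phi> x\<bar> * \<bar>lin J \<psi> v\<bar>) \<le> real_of_int (\<bar>lin J \<phi> v\<bar> * \<bar>lin J \<psi> x\<bar>)"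
      using False \<phi>(1) by (simp add: ratio_def L_def field_simps)
    then show ?thesis by linarith
  qed simp
  have "lin J \<phi> x \<noteq> 0"
    using assms(1) \<phi>(1) by (auto simp: L_def conformal_def sign_compatible_def sgn_0_0)
  then show ?thesis using that \<phi>(1) le by (auto simp: L_def)
qed

text \<open>
  One step of the decomposition of \<open>x\<close> into conformal vectors, cleared of denominators: the
  vector \<open>x - (p / q) v\<close> is still conformal to \<open>x\<close> and has at least one more zero.
\<close>

lemma subtract_conformal:
  assumes "conformal v x" "nonzero v"
  obtains q p where "0 < q" "0 \<le> p"
    "\<And>\<psi>. \<psi> \<in> \<Phi> \<Longrightarrow> p * \<bar>lin J \<psi> v\<bar> \<le> q * \<bar>lin J \<psi> x\<bar>"
    "\<And>\<psi>. \<psi> \<in> \<Phi> \<Longrightarrow> between (lin J \<psi> (\<lambda>j. q * x j - p * v j)) (q * lin J \<psi> x)"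
    "card {\<psi> \<in> \<Phi>. lin J \<psi> (\<lambda>j. q * x j - p * v j) \<noteq> 0} < card {\<psi> \<in> \<Phi>. lin J \<psi> x \<noteq> 0}"
proof -
  obtain \<phi> where \<phi>: "\<phi> \<in> \<Phi>" "lin J \<phi> v \<noteq> 0" "lin J \<phi> x \<noteq> 0"
    "\<And>\<psi>. \<psi> \<in> \<Phi> \<Longrightarrow> \<bar>lin J \<phi> x\<bar> * \<bar>lin J \<psi> v\<bar> \<le> \<bar>lin J \<phi> v\<bar> * \<bar>lin J \<psi> x\<bar>"
    by (fact smallest_ratio[OF assms])
  define p q where "p = \<bar>lin J \<phi> x\<bar>" and "q = \<bar>lin J \<phi> v\<bar>"
  let ?x' = "\<lambda>j. q * x j - p * v j"
  have pq: "0 < q" "0 \<le> p" using \<phi> by (auto simp: p_def q_def)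
  have btw: "between (lin J \<psi> ?x') (q * lin J \<psi> x)" if "\<psi> \<in> \<Phi>" for \<psi>
    unfolding lin_combination using assms(1) \<phi>(4) that pq
    by (intro between_combination) (auto simp: conformal_def p_def q_def)
  have "sign_compatible (lin J \<phi> v) (lin J \<phi> x)" using assms(1) \<phi>(1) by (simp add: conformal_def)
  then have "lin J \<phi> ?x' = 0"
    unfolding lin_combination p_def q_def using \<phi>(2,3)
    by (auto simp: sign_compatible_def sgn_if abs_if split: if_splits)
  moreover have "lin J \<psi> x \<noteq> 0" if "\<psi> \<in> \<Phi>" "lin J \<psi> ?x' \<noteq> 0" for \<psi>
    using btw[OF that(1)] that(2) by (auto simp: between_def)
  ultimately have "{\<psi> \<in> \<Phi>. lin J \<psi> ?x' \<noteq> 0} \<subset> {\<psi> \<in> \<Phi>. lin J \<psi> x \<noteq> 0}"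
    using \<phi>(1,3) by blast
  then have "card {\<psi> \<in> \<Phi>. lin J \<psi> ?x' \<noteq> 0} < card {\<psi> \<in> \<Phi>. lin J \<psi> x \<noteq> 0}"
    using finite_\<Phi> by (intro psubset_card_mono) auto
  then show ?thesis
  proof (rule that[OF pq, rotated -1])
    show "p * \<bar>lin J \<psi> v\<bar> \<le> q * \<bar>lin J \<psi> x\<bar>" if "\<psi> \<in> \<Phi>" for \<psi>
      unfolding p_def q_def by (rule \<phi>(4)[OF that])
    show "between (lin J \<psi> ?x') (q * lin J \<psi> x)" if "\<psi> \<in> \<Phi>" for \<psi>
      by (rule btw[OF that])
  qed
qed

text \<open>
  Among the nonzero vectors conformal to \<open>x\<close> choose \<open>y\<close> with as many zeros as possible, and
  take a short vector \<open>v\<close> in the common kernel of the forms that vanish on \<open>y\<close>. Subtracting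
  multiples of \<open>v\<close> from \<open>y\<close> creates a new zero, so by the choice of \<open>y\<close> the result is \<open>0\<close>.
  Hence \<open>v\<close> is a multiple of \<open>y\<close>, and up to its sign it is conformal to \<open>x\<close>.
\<close>

lemma short_conformal_vector:
  assumes "nonzero x"
  shows "\<exists>v. nonzero v \<and> conformal v x \<and> (\<forall>j\<in>J. \<bar>v j\<bar> \<le> height)"
proof -
  define N where "N y = card {\<psi> \<in> \<Phi>. lin J \<psi> y \<noteq> 0}" for y
  have "nonzero x \<and> conformal x x" using assms by (simp add: conformal_def sign_compatible_def)
  then obtain y where y: "nonzero y" "conformal y x"
    and least: "\<And>z. nonzero z \<Longrightarrow> conformal z x \<Longrightarrow> N y \<le> N z"
    using ex_has_least_nat[of "\<lambda>y. nonzero y \<and> conformal y x" x N] by blast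
  define Z where "Z = {\<phi> \<in> \<Phi>. lin J \<phi> y = 0}"
  obtain K where K: "K \<subseteq> Z" "card K < card J"
    "\<And>v. (\<forall>\<phi>\<in>K. lin J \<phi> v = 0) \<Longrightarrow> (\<forall>\<phi>\<in>Z. lin J \<phi> v = 0)"
  proof -
    have "finite Z" "\<forall>\<phi>\<in>Z. lin J \<phi> y = 0" using finite_\<Phi> by (auto simp: Z_def)
    then show ?thesis using kernel_cut_by_few_forms[OF finite_J _ _ y(1), of Z] that by blast
  qed
  have finK: "finite K" using finite_subset[OF K(1)] finite_\<Phi> by (simp add: Z_def)
  obtain v0 where v0: "nonzero v0" "\<forall>\<phi>\<in>K. lin J \<phi> v0 = 0" "\<forall>j\<in>J. \<bar>v0 j\<bar> \<le> int c ^ card K"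
  proof -
    have "(\<Sum>j\<in>J. \<bar>\<phi> j\<bar>) \<le> int c" if "\<phi> \<in> K" for \<phi>
      using norm K(1) that by (auto simp: Z_def)
    then show ?thesis using small_kernel_vector[OF finite_J finK K(2) c_pos, of "\<lambda>\<phi>. \<phi>"] that by blast
  qed
  have ker: "lin J \<phi> v0 = 0" if "\<phi> \<in> \<Phi>" "lin J \<phi> y = 0" for \<phi>
    using K(3)[OF v0(2)] that by (auto simp: Z_def)
  have "int c ^ card K \<le> height" unfolding height_def using K(2) c_pos by (intro power_increasing) auto
  then have bnd: "\<bar>v0 j\<bar> \<le> height" if "j \<in> J" for j using v0(3) that by force
  obtain j0 where j0: "j0 \<in> J" "v0 j0 \<noteq> 0" using v0(1) by blast
  define L where "L = {\<phi> \<in> \<Phi>. lin J \<phi> y \<noteq> 0}"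
  define ratio where "ratio \<phi> = real_of_int (lin J \<phi> v0) / real_of_int (lin J \<phi> y)" for \<phi>
  have j0L: "unit_form j0 \<in> L" "lin J (unit_form j0) v0 \<noteq> 0"
    using j0 finite_J ker[of "unit_form j0"] unit_forms[of j0] by (auto simp: L_def lin_unit_form)
  \<comment> \<open>This sign makes v and y agree in sign on the coordinate form of j0.\<close>
  define \<epsilon> :: int where "\<epsilon> = (if ratio (unit_form j0) > 0 then 1 else -1)"
  have \<epsilon>: "\<epsilon> * \<epsilon> = 1" "\<bar>\<epsilon>\<bar> = 1" by (auto simp: \<epsilon>_def)
  define v where "v j = \<epsilon> * v0 j" for j
  define ratio' where "ratio' \<phi> = real_of_int (lin J \<phi> v) / real_of_int (lin J \<phi> y)" for \<phi>
  have linv: "lin J \<phi> v = \<epsilon> * lin J \<phi> v0" for \<phi> unfolding v_def by (rule lin_scale)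
  have pos: "0 < ratio' (unit_form j0)"
    using j0L by (auto simp: ratio'_def ratio_def linv \<epsilon>_def L_def zero_less_divide_iff divide_less_0_iff)
  have L: "finite L" "L \<noteq> {}" using finite_\<Phi> j0L(1) by (auto simp: L_def)
  define \<phi> where "\<phi> = arg_min_on (\<lambda>\<phi>. - ratio' \<phi>) L"
  have \<phi>: "\<phi> \<in> L" "\<And>\<psi>. \<psi> \<in> L \<Longrightarrow> ratio' \<psi> \<le> ratio' \<phi>"
    using arg_min_if_finite(1)[OF L] arg_min_least[OF L, of _ "\<lambda>\<phi>. - ratio' \<phi>"] by (simp_all add: \<phi>_def)
  have \<phi>pos: "0 < ratio' \<phi>" using pos \<phi>(2)[OF j0L(1)] by linarith
  define s where "s = sgn (lin J \<phi> y)"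
  \<comment> \<open>Here \<phi> has the largest ratio of its values on v and y. The vector z is a positive
  multiple of y - v / ratio, so it vanishes on \<phi> and stays conformal to y.\<close>
  define z where "z j = s * lin J \<phi> v * y j - s * lin J \<phi> y * v j" for j
  have linz: "lin J \<psi> z = s * lin J \<phi> v * lin J \<psi> y - s * lin J \<phi> y * lin J \<psi> v" for \<psi>
    unfolding z_def by (rule lin_combination)
  have sy: "s * lin J \<phi> y > 0" using \<phi>(1) by (auto simp: s_def L_def sgn_if)
  have sv: "s * lin J \<phi> v > 0"
    using \<phi>pos by (auto simp: ratio'_def s_def sgn_if zero_less_divide_iff)
  have zy: "sign_compatible (lin J \<psi> z) (lin J \<psi> y)" if \<psi>: "\<psi> \<in> \<Phi>" for \<psi>
  proof (cases "lin J \<psi> y = 0")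
    case True
    then show ?thesis using ker[OF \<psi>] by (simp add: linz linv sign_compatible_def)
  next
    case False
    then have "ratio' \<psi> \<le> ratio' \<phi>" using \<phi>(2) \<psi> by (auto simp: L_def)
    moreover have "0 \<le> real_of_int (s * lin J \<phi> y)" using sy by linarith
    ultimately have "0 \<le> real_of_int (s * lin J \<phi> y) * (ratio' \<phi> - ratio' \<psi>)
      * (real_of_int (lin J \<psi> y) * real_of_int (lin J \<psi> y))"
      by (intro mult_nonneg_nonneg zero_le_square) auto
    also have "\<dots> = real_of_int (lin J \<psi> z) * real_of_int (lin J \<psi> y)"
      using False \<phi>(1) by (simp add: linz ratio'_def L_def field_simps)
    finally have "0 \<le> real_of_int (lin J \<psi> z) * real_of_int (lin J \<psi> y)" .
    then have "0 \<le> lin J \<psi> z * lin J \<psi> y" by (metis of_int_0_le_iff of_int_mult)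
    then show ?thesis using False by (auto simp: sign_compatible_def sgn_if zero_le_mult_iff)
  qed
  have "\<not> nonzero z"
  proof
    assume "nonzero z"
    moreover have "conformal z x"
      using zy y(2) by (auto simp: conformal_def intro: sign_compatible_trans)
    ultimately have "N y \<le> N z" by (rule least)
    have "lin J \<phi> z = 0" by (simp add: linz)
    moreover have "lin J \<psi> y \<noteq> 0" if "\<psi> \<in> \<Phi>" "lin J \<psi> z \<noteq> 0" for \<psi>
      using zy[OF that(1)] that(2) by (auto simp: sign_compatible_def sgn_0_0)
    ultimately have "{\<psi> \<in> \<Phi>. lin J \<psi> z \<noteq> 0} \<subset> {\<psi> \<in> \<Phi>. lin J \<psi> y \<noteq> 0}"
      using \<phi>(1) unfolding L_def by blast
    then have "N z < N y" unfolding N_def using finite_\<Phi> by (intro psubset_card_mono) auto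
    with \<open>N y \<le> N z\<close> show False by simp
  qed
  then have zero: "z j = 0" if "j \<in> J" for j using that by blast
  have "sign_compatible (lin J \<psi> v) (lin J \<psi> y)" if \<psi>: "\<psi> \<in> \<Phi>" for \<psi>
  proof -
    have "lin J \<psi> z = 0" using zero by (simp add: lin_def)
    then have eq: "(s * lin J \<phi> v) * lin J \<psi> y = (s * lin J \<phi> y) * lin J \<psi> v" by (simp add: linz)
    have "sgn (lin J \<psi> y) = sgn (lin J \<psi> v)"
      using arg_cong[OF eq, of sgn] sv sy by (simp add: sgn_mult[of "s * _"])
    then show ?thesis by (simp add: sign_compatible_def)
  qed
  then have "conformal v x" using y(2) by (auto simp: conformal_def intro: sign_compatible_trans)
  moreover have "nonzero v" using j0 \<epsilon> by (auto simp: v_def intro!: bexI[of _ j0])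
  moreover have "\<forall>j\<in>J. \<bar>v j\<bar> \<le> height" using bnd \<epsilon> by (simp add: v_def abs_mult)
  ultimately show ?thesis by blast
qed

text \<open>
  The scale \<open>D\<close> makes the decomposition of the rational vector \<open>x / D\<close> possible over the
  integers. Irreducibility says that no integer vector with \<open>v t = 0\<close> can be split off from
  \<open>x / D\<close>. Thus each short vector occurs with coefficient at most \<open>1\<close>: a larger one would
  contradict irreducibility if \<open>v t = 0\<close>, and \<open>\<bar>x t / D\<bar> \<le> 1\<close> otherwise. Each step adds a
  zero, so the number of steps is at most the number of nonvanishing forms.
\<close>

lemma bound_if_irreducible:
  assumes t: "t \<in> J" and D: "0 < D" "\<bar>x t\<bar> \<le> D"
    and irred: "\<And>v. nonzero v \<Longrightarrow> v t = 0 \<Longrightarrow> \<exists>\<phi>\<in>\<Phi>. \<not> between (D * lin J \<phi> v) (lin J \<phi> x)"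
    and j: "j \<in> J"
  shows "\<bar>x j\<bar> \<le> int (card {\<phi> \<in> \<Phi>. lin J \<phi> x \<noteq> 0}) * height * D"
  using D irred
proof (induction "card {\<phi> \<in> \<Phi>. lin J \<phi> x \<noteq> 0}" arbitrary: x D rule: less_induct)
  case less
  show ?case
  proof (cases "nonzero x")
    case False
    then show ?thesis using j less.prems(1) by (auto simp: height_def)
  next
    case True
    obtain v where v: "nonzero v" "conformal v x" "\<And>j. j \<in> J \<Longrightarrow> \<bar>v j\<bar> \<le> height"
      using short_conformal_vector[OF True] by blast
    obtain q p where pq: "0 < q" "0 \<le> p"
      and ratio: "\<And>\<psi>. \<psi> \<in> \<Phi> \<Longrightarrow> p * \<bar>lin J \<psi> v\<bar> \<le> q * \<bar>lin J \<psi> x\<bar>"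
      and btw: "\<And>\<psi>. \<psi> \<in> \<Phi> \<Longrightarrow> between (lin J \<psi> (\<lambda>j. q * x j - p * v j)) (q * lin J \<psi> x)"
      and fewer: "card {\<psi> \<in> \<Phi>. lin J \<psi> (\<lambda>j. q * x j - p * v j) \<noteq> 0} < card {\<psi> \<in> \<Phi>. lin J \<psi> x \<noteq> 0}"
      by (fact subtract_conformal[OF v(2,1)])
    let ?x' = "\<lambda>j. q * x j - p * v j"
    have ut: "unit_form t \<in> \<Phi>" "lin J (unit_form t) z = z t" for z
      using t finite_J by (auto simp: unit_forms lin_unit_form)
    \<comment> \<open>The coefficient of v in the decomposition of x / D is p / (D * q).\<close>
    have p: "p \<le> D * q"
    proof -
      obtain \<psi> where \<psi>: "\<psi> \<in> \<Phi>" "lin J \<psi> v \<noteq> 0" "\<bar>lin J \<psi> x\<bar> \<le> D * \<bar>lin J \<psi> v\<bar>"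
      proof (cases "v t = 0")
        case True
        then obtain \<psi> where \<psi>: "\<psi> \<in> \<Phi>" "\<not> between (D * lin J \<psi> v) (lin J \<psi> x)"
          using less.prems(3)[OF v(1)] by blast
        have "sign_compatible (lin J \<psi> v) (lin J \<psi> x)" using v(2) \<psi>(1) by (simp add: conformal_def)
        then have "lin J \<psi> v \<noteq> 0" "\<bar>lin J \<psi> x\<bar> \<le> D * \<bar>lin J \<psi> v\<bar>"
          using \<psi>(2) less.prems(1) by (auto simp: between_def sign_compatible_def sgn_mult abs_mult)
        then show ?thesis using that \<psi>(1) by blast
      next
        case False
        then have "\<bar>v t\<bar> \<ge> 1" by linarith
        then have "D * 1 \<le> D * \<bar>v t\<bar>" using less.prems(1) by (intro mult_left_mono) auto
        then show ?thesis using that[OF ut(1)] False less.prems(2) ut(2) by simp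
      qed
      have "p * \<bar>lin J \<psi> v\<bar> \<le> q * \<bar>lin J \<psi> x\<bar>" by (rule ratio[OF \<psi>(1)])
      also have "\<dots> \<le> q * (D * \<bar>lin J \<psi> v\<bar>)" using pq \<psi>(3) by (intro mult_left_mono) auto
      finally have "p * \<bar>lin J \<psi> v\<bar> \<le> (D * q) * \<bar>lin J \<psi> v\<bar>" by (simp add: mult_ac)
      then show ?thesis using \<psi>(2) by simp
    qed
    have D': "0 < q * D" using pq less.prems(1) by simp
    have "\<bar>?x' t\<bar> \<le> \<bar>q * x t\<bar>" using btw[OF ut(1)] ut(2) by (simp add: between_def)
    moreover have "\<bar>q * x t\<bar> \<le> q * D" using pq less.prems(2) by (simp add: abs_mult)
    ultimately have x't: "\<bar>?x' t\<bar> \<le> q * D" by linarith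
    have irred': "\<exists>\<phi>\<in>\<Phi>. \<not> between (q * D * lin J \<phi> w) (lin J \<phi> ?x')" if w: "nonzero w" "w t = 0" for w
    proof -
      obtain \<phi> where \<phi>: "\<phi> \<in> \<Phi>" "\<not> between (D * lin J \<phi> w) (lin J \<phi> x)"
        using less.prems(3)[OF w] by blast
      then have "\<not> between (q * (D * lin J \<phi> w)) (q * lin J \<phi> x)"
        using pq(1) by (simp add: between_scale_iff)
      then have "\<not> between (q * D * lin J \<phi> w) (lin J \<phi> ?x')"
        using between_trans[OF _ btw[OF \<phi>(1)]] by (auto simp only: mult.assoc)
      then show ?thesis using \<phi>(1) by blast
    qed
    define m' where "m' = card {\<psi> \<in> \<Phi>. lin J \<psi> ?x' \<noteq> 0}"
    define m where "m = card {\<psi> \<in> \<Phi>. lin J \<psi> x \<noteq> 0}"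
    have H0: "0 \<le> height" by (simp add: height_def)
    have "\<bar>?x' j\<bar> \<le> int m' * height * (q * D)"
      using less.hyps[OF fewer D' x't irred'] by (simp add: m'_def)
    moreover have "p * \<bar>v j\<bar> \<le> (D * q) * height"
      using p v(3)[OF j] pq less.prems(1) by (intro mult_mono) auto
    moreover have "\<bar>q * x j\<bar> \<le> \<bar>?x' j\<bar> + p * \<bar>v j\<bar>"
      using pq(2) abs_triangle_ineq[of "?x' j" "p * v j"] by (simp add: abs_mult)
    ultimately have "q * \<bar>x j\<bar> \<le> int m' * height * (q * D) + D * q * height"
      using pq(1) by (simp add: abs_mult)
    also have "\<dots> = q * (int (Suc m') * height * D)" by (simp add: algebra_simps)
    also have "\<dots> \<le> q * (int m * height * D)"
      using fewer pq(1) H0 less.prems(1) unfolding m_def m'_def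
      by (intro mult_left_mono mult_right_mono) auto
    finally show ?thesis using pq(1) by (simp add: m_def)
  qed
qed

text \<open>
  The coordinate \<open>t\<close> homogenizes an inhomogeneous system: solutions have \<open>t\<close>-entry \<open>1\<close>, and
  vectors with \<open>t\<close>-entry \<open>0\<close> can be subtracted from them. A solution that is minimal in the
  \<open>l\<^sup>1\<close>-norm among those between \<open>0\<close> and \<open>x\<close> admits no such subtraction, and so it is short.
\<close>

lemma short_conformal_part:
  assumes t: "t \<in> J" and x: "x t = 1"
  obtains h where "h t = 1" "\<And>\<phi>. \<phi> \<in> \<Phi> \<Longrightarrow> between (lin J \<phi> h) (lin J \<phi> x)"
    "\<And>j. j \<in> J \<Longrightarrow> \<bar>h j\<bar> \<le> int (card \<Phi>) * height"
proof -
  define P where "P h \<longleftrightarrow> h t = 1 \<and> (\<forall>\<phi>\<in>\<Phi>. between (lin J \<phi> h) (lin J \<phi> x))" for h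
  define S where "S h = nat (\<Sum>j\<in>J. \<bar>h j\<bar>)" for h
  have "P x" using x by (simp add: P_def between_def sign_compatible_def)
  then obtain h where h: "P h" and least: "\<And>g. P g \<Longrightarrow> S h \<le> S g"
    using ex_has_least_nat[of P x S] by blast
  have irred: "\<exists>\<phi>\<in>\<Phi>. \<not> between (1 * lin J \<phi> v) (lin J \<phi> h)" if v: "nonzero v" "v t = 0" for v
  proof (rule ccontr)
    assume "\<not> ?thesis"
    then have b: "\<And>\<phi>. \<phi> \<in> \<Phi> \<Longrightarrow> between (lin J \<phi> v) (lin J \<phi> h)" by auto
    let ?g = "\<lambda>j. h j - v j"
    have b': "between (lin J \<phi> ?g) (lin J \<phi> h)" if "\<phi> \<in> \<Phi>" for \<phi>
      using b[OF that] unfolding lin_diff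
      by (auto simp: between_def sign_compatible_def sgn_if split: if_splits)
    have "P ?g" using h v(2) b' between_trans by (fastforce simp: P_def)
    then have SS: "S h \<le> S ?g" by (rule least)
    have le: "\<bar>?g j\<bar> = \<bar>h j\<bar> - \<bar>v j\<bar>" if "j \<in> J" for j
      using b[OF unit_forms[OF that]] that finite_J
      by (auto simp: lin_unit_form between_def sign_compatible_def sgn_if split: if_splits)
    have less: "(\<Sum>j\<in>J. \<bar>?g j\<bar>) < (\<Sum>j\<in>J. \<bar>h j\<bar>)"
      using v(1) finite_J le by (intro sum_strict_mono_ex1) auto
    have "0 \<le> (\<Sum>j\<in>J. \<bar>?g j\<bar>)" by (intro sum_nonneg) auto
    then show False using SS less unfolding S_def by linarith
  qed
  have "\<bar>h j\<bar> \<le> int (card \<Phi>) * height" if j: "j \<in> J" for j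
  proof -
    have "\<bar>h j\<bar> \<le> int (card {\<phi> \<in> \<Phi>. lin J \<phi> h \<noteq> 0}) * height * 1"
      using h irred by (intro bound_if_irreducible[OF t _ _ _ j]) (auto simp: P_def)
    moreover have "int (card {\<phi> \<in> \<Phi>. lin J \<phi> h \<noteq> 0}) * height * 1 \<le> int (card \<Phi>) * height"
      using finite_\<Phi> by (auto intro!: mult_right_mono card_mono simp: height_def)
    ultimately show ?thesis by linarith
  qed
  then show ?thesis using that h by (auto simp: P_def)
qed

end

section \<open>Integer programs attached to a monomial ideal\<close>

text \<open>
  The rows \<open>F\<close> stand for the variables that survive after all the others are set to \<open>1\<close>.
  With \<open>a g\<close> the exponent vector of the generator \<open>g\<close>, the relation \<open>sol u b n\<close> says that
  the product of \<open>n\<close> generators in which \<open>g\<close> occurs \<open>u g\<close> times divides \<open>x\<^sup>b\<close> after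
  this substitution.
\<close>

locale exponents =
  fixes E :: "'g set" and a :: "'g \<Rightarrow> 'n \<Rightarrow> nat" and F :: "'n set"
begin

definition sol :: "('g \<Rightarrow> nat) \<Rightarrow> ('n \<Rightarrow> nat) \<Rightarrow> nat \<Rightarrow> bool" where
  "sol u b n \<longleftrightarrow> (\<Sum>g\<in>E. u g) = n \<and> (\<forall>i\<in>F. (\<Sum>g\<in>E. u g * a g i) \<le> b i)"

definition fits :: "('n \<Rightarrow> nat) \<Rightarrow> nat \<Rightarrow> bool" where
  "fits b n \<longleftrightarrow> (\<exists>u. sol u b n)"

text \<open>
  In the ring where the variables outside \<open>F\<close> are set to \<open>1\<close>, the annihilator of the class of
  \<open>x\<^sup>b\<close> modulo the \<open>(n + 1)\<close>-st power of the ideal is the maximal ideal \<open>(F)\<close>.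
\<close>

definition critical :: "('n \<Rightarrow> nat) \<Rightarrow> nat \<Rightarrow> bool" where
  "critical b n \<longleftrightarrow> fits b n \<and> \<not> fits b (Suc n) \<and>
    (\<forall>i\<in>F. fits (\<lambda>k. b k + of_bool (k = i)) (Suc n))"

lemma sol_add:
  assumes "finite E" "sol u b n" "g \<in> E"
  shows "sol (u(g := Suc (u g))) (\<lambda>i. b i + a g i) (Suc n)"
  using assms by (auto simp: sol_def sum.remove[of E g] cong: sum.cong_simp)

lemma sol_remove:
  assumes "finite E" "sol u (\<lambda>i. b i + a g i) (Suc n)" "g \<in> E" "0 < u g"
  shows "sol (u(g := u g - 1)) b n"
proof -
  obtain m where "u g = Suc m" using assms(4) gr0_conv_Suc by blast
  then show ?thesis
    using assms by (auto simp: sol_def sum.remove[of E g] cong: sum.cong_simp)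
qed

lemma sol_cong:
  assumes "\<And>i. i \<in> F \<Longrightarrow> b i = b' i"
  shows "sol u b n \<longleftrightarrow> sol u b' n"
  using assms by (simp add: sol_def)

lemma sol_mono:
  assumes "sol u b n" "\<And>i. i \<in> F \<Longrightarrow> b i \<le> b' i"
  shows "sol u b' n"
  using assms by (auto simp: sol_def intro: order_trans)

lemma le_of_sol:
  assumes "finite E" "sol u b n" "g \<in> E" "0 < u g" "i \<in> F"
  shows "a g i \<le> b i"
proof -
  have "a g i \<le> u g * a g i" using assms(4) by (cases "u g") auto
  also have "\<dots> \<le> (\<Sum>g\<in>E. u g * a g i)"
    using assms(1,3) by (intro member_le_sum) auto
  also have "\<dots> \<le> b i" using assms(2,5) by (simp add: sol_def)
  finally show ?thesis .
qed

end

locale exponent_system = exponents E a F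
  for E :: "'g set" and a :: "'g \<Rightarrow> 'n \<Rightarrow> nat" and F :: "'n set" +
  fixes d :: nat
  assumes finite_E: "finite E" and finite_F: "finite F" and d_pos: "1 \<le> d"
    and degree_le: "\<And>g i. g \<in> E \<Longrightarrow> i \<in> F \<Longrightarrow> a g i \<le> d"
begin

text \<open>
  The number of forms used in \<open>nearby_solution\<close> is at most the first factor, namely \<open>card E + 1\<close>
  coordinates, one form for the total and one for each row. The \<open>l\<^sup>1\<close>-norms of these forms are
  bounded by \<open>(card E + 2) * d\<close>.
\<close>

definition proximity :: nat where
  "proximity = (card E + card F + 2) * ((card E + 2) * d) ^ card E"

text \<open>
  The difference \<open>w - u\<close>, homogenized by an extra coordinate \<open>None\<close> with value \<open>1\<close>, is replaced
  by a short conformal vector \<open>h\<close>. Being conformal in the coordinates keeps \<open>u + h\<close>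
  nonnegative. The form \<open>size\<close> vanishes on the difference, so \<open>u + h\<close> has the total of \<open>w\<close>. The
  value of \<open>row i\<close> is the slack of \<open>u\<close> minus the slack of \<open>w\<close>, so the slack of \<open>u + h\<close> lies
  between these two and is nonnegative.
\<close>

lemma nearby_solution:
  assumes u: "sol u b n" and w: "sol w (\<lambda>i. b i + f i) (n + q)"
    and f: "\<And>i. i \<in> F \<Longrightarrow> f i \<le> d" and q: "q \<le> 2"
  shows "\<exists>w'. sol w' (\<lambda>i. b i + f i) (n + q) \<and> (\<forall>g\<in>E. u g \<le> w' g + proximity)"
proof -
  define J where "J = insert None (Some ` E)"
  define size :: "'g option \<Rightarrow> int" where
    "size j = (case j of None \<Rightarrow> - int q | Some g \<Rightarrow> 1)" for j
  define row :: "'n \<Rightarrow> 'g option \<Rightarrow> int" where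
    "row i j = (case j of None \<Rightarrow> - int (f i) | Some g \<Rightarrow> int (a g i))" for i j
  define \<Phi> where "\<Phi> = unit_form ` J \<union> ({size} \<union> row ` F)"
  define c where "c = (card E + 2) * d"
  have finJ: "finite J" using finite_E by (simp add: J_def)
  have sumJ: "(\<Sum>j\<in>J. k j) = k None + (\<Sum>g\<in>E. k (Some g))" for k :: "_ \<Rightarrow> int"
    unfolding J_def using finite_E by (subst sum.insert) (auto simp: sum.reindex)
  have cardJ: "card J = Suc (card E)"
    unfolding J_def using finite_E by (subst card_insert_disjoint) (auto simp: card_image)
  have cd: "card E + 2 \<le> c" unfolding c_def using mult_le_mono2[OF d_pos, of "card E + 2"] by simp
  interpret integer_forms J \<Phi> c
  proof
    show "finite J" by (fact finJ)
    show "finite \<Phi>" using finJ finite_F by (simp add: \<Phi>_def)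
    show "1 \<le> c" using cd by simp
    show "unit_form j \<in> \<Phi>" if "j \<in> J" for j using that by (simp add: \<Phi>_def)
    fix \<phi> assume "\<phi> \<in> \<Phi>"
    then consider j where "j \<in> J" "\<phi> = unit_form j" | "\<phi> = size" | i where "i \<in> F" "\<phi> = row i"
      by (auto simp: \<Phi>_def)
    then show "(\<Sum>j\<in>J. \<bar>\<phi> j\<bar>) \<le> int c"
    proof cases
      case 1
      then have "(\<Sum>j\<in>J. \<bar>\<phi> j\<bar>) = 1"
        using finJ by (subst sum.remove[of J j]) (auto simp: unit_form_def intro!: sum.neutral)
      then show ?thesis using cd by simp
    next
      case 2
      then show ?thesis using cd q by (simp add: sumJ size_def)
    next
      case 3
      have "(\<Sum>g\<in>E. int (a g i)) \<le> (\<Sum>g\<in>E. int d)"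
        using degree_le 3(1) by (intro sum_mono) simp
      moreover have "int (f i) \<le> int d" using f 3(1) by simp
      ultimately show ?thesis using 3(2) by (simp add: sumJ row_def c_def algebra_simps)
    qed
  qed
  define x :: "'g option \<Rightarrow> int" where
    "x j = (case j of None \<Rightarrow> 1 | Some g \<Rightarrow> int (w g) - int (u g))" for j
  have None_J: "None \<in> J" by (simp add: J_def)
  obtain h where h: "h None = 1" "\<And>\<phi>. \<phi> \<in> \<Phi> \<Longrightarrow> between (lin J \<phi> h) (lin J \<phi> x)"
    "\<And>j. j \<in> J \<Longrightarrow> \<bar>h j\<bar> \<le> int (card \<Phi>) * height"
    by (rule short_conformal_part[OF None_J, of x]) (auto simp: x_def)
  have "card \<Phi> \<le> card (unit_form ` J) + (card {size} + card (row ` F))"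
    unfolding \<Phi>_def by (intro order_trans[OF card_Un_le] add_left_mono card_Un_le)
  also have "\<dots> \<le> Suc (card E) + (1 + card F)"
    using card_image_le[OF finJ, of unit_form] card_image_le[OF finite_F, of row] cardJ by simp
  finally have card_\<Phi>: "card \<Phi> \<le> card E + card F + 2" by simp
  have "int (card \<Phi>) * height \<le> int proximity"
    unfolding height_def unfolding proximity_def cardJ c_def of_nat_mult of_nat_power using card_\<Phi>
    by (intro mult_mono) auto
  then have hbound: "\<bar>h (Some g)\<bar> \<le> int proximity" if "g \<in> E" for g
    using h(3)[of "Some g"] that by (simp add: J_def)
  have hunit: "between (h (Some g)) (int (w g) - int (u g))" if "g \<in> E" for g
  proof -
    have "Some g \<in> J" using that by (simp add: J_def)
    then have "between (h (Some g)) (x (Some g))"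
      using h(2)[OF unit_forms] finJ by (simp add: lin_unit_form)
    then show ?thesis by (simp add: x_def)
  qed
  define w' where "w' g = nat (int (u g) + h (Some g))" for g
  have w': "int (w' g) = int (u g) + h (Some g)" if "g \<in> E" for g
    using hunit[OF that] by (auto simp: w'_def between_def sign_compatible_def sgn_if split: if_splits)
  have "lin J size x = 0"
    using u w by (simp add: lin_def sumJ size_def x_def sol_def sum_subtractf flip: of_nat_sum)
  then have "lin J size h = 0" using h(2)[of size] by (simp add: \<Phi>_def between_def)
  then have "(\<Sum>g\<in>E. h (Some g)) = int q" using h(1) by (simp add: lin_def sumJ size_def)
  moreover have "(\<Sum>g\<in>E. int (u g)) = int n" using u by (simp add: sol_def flip: of_nat_sum)
  moreover have "int (\<Sum>g\<in>E. w' g) = (\<Sum>g\<in>E. int (u g)) + (\<Sum>g\<in>E. h (Some g))"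
    using w' by (simp add: sum.distrib)
  ultimately have "int (\<Sum>g\<in>E. w' g) = int (n + q)" by linarith
  then have total: "(\<Sum>g\<in>E. w' g) = n + q" by linarith
  have rows: "(\<Sum>g\<in>E. w' g * a g i) \<le> b i + f i" if i: "i \<in> F" for i
  proof -
    define U W V where "U = (\<Sum>g\<in>E. int (u g) * int (a g i))"
      and "W = (\<Sum>g\<in>E. int (w g) * int (a g i))" and "V = (\<Sum>g\<in>E. h (Some g) * int (a g i))"
    have "U = int (\<Sum>g\<in>E. u g * a g i)" "W = int (\<Sum>g\<in>E. w g * a g i)"
      by (simp_all add: U_def W_def)
    then have UW: "U \<le> int (b i)" "W \<le> int (b i) + int (f i)"
      using u w i by (force simp: sol_def simp del: of_nat_sum)+
    have "lin J (row i) x = W - U - int (f i)"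
      by (simp add: lin_def sumJ row_def x_def U_def W_def algebra_simps sum_subtractf)
    moreover have "lin J (row i) h = V - int (f i)"
      using h(1) by (simp add: lin_def sumJ row_def V_def mult.commute)
    moreover have "between (lin J (row i) h) (lin J (row i) x)"
      using h(2)[of "row i"] i by (simp add: \<Phi>_def)
    ultimately have "U + V \<le> int (b i) + int (f i)"
      using UW by (auto simp: between_def sign_compatible_def sgn_if split: if_splits)
    moreover have "int (\<Sum>g\<in>E. w' g * a g i) = U + V"
      using w' by (simp add: U_def V_def algebra_simps sum.distrib)
    ultimately show ?thesis by linarith
  qed
  have "u g \<le> w' g + proximity" if "g \<in> E" for g
    using hbound[OF that] w'[OF that] by linarith
  then show ?thesis using total rows by (auto simp: sol_def)
qed

lemma large_entry:
  assumes "sol u b n" "card E * proximity < n"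
  obtains g where "g \<in> E" "proximity < u g"
proof -
  have "\<exists>g\<in>E. proximity < u g"
  proof (rule ccontr)
    assume "\<not> ?thesis"
    then have "(\<Sum>g\<in>E. u g) \<le> card E * proximity" using sum_bounded_above[of E u proximity] by force
    then show False using assms by (simp add: sol_def)
  qed
  then show ?thesis using that by blast
qed

text \<open>
  If a vector with total \<open>n + 2\<close> fitted below \<open>b + g\<close>, one close to \<open>u\<close> would also do. That one
  contains \<open>g\<close>, and removing \<open>g\<close> would leave a vector with total \<open>n + 1\<close> below \<open>b\<close>.
\<close>

lemma critical_up:
  assumes "critical b n" "card E * proximity < n"
  shows "\<exists>b'. critical b' (Suc n)"
proof -
  obtain u where u: "sol u b n" using assms(1) by (auto simp: critical_def fits_def)
  obtain g where g: "g \<in> E" "proximity < u g" by (rule large_entry[OF u assms(2)])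
  let ?b = "\<lambda>i. b i + a g i"
  have "fits ?b (Suc n)" using sol_add[OF finite_E u g(1)] by (auto simp: fits_def)
  moreover have "\<not> fits ?b (Suc (Suc n))"
  proof
    assume "fits ?b (Suc (Suc n))"
    then obtain w where "sol w ?b (n + 2)" by (auto simp: fits_def)
    from nearby_solution[OF u this] degree_le[OF g(1)] obtain w'
      where w': "sol w' ?b (n + 2)" "\<forall>g\<in>E. u g \<le> w' g + proximity" by auto
    then have "0 < w' g" using g by fastforce
    then have "sol (w'(g := w' g - 1)) b (Suc n)"
      using w'(1) g(1) by (intro sol_remove finite_E) auto
    then show False using assms(1) by (auto simp: critical_def fits_def)
  qed
  moreover have "fits (\<lambda>k. ?b k + of_bool (k = i)) (Suc (Suc n))" if "i \<in> F" for i
  proof -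
    have "fits (\<lambda>k. b k + of_bool (k = i)) (Suc n)"
      using assms(1) that by (simp add: critical_def)
    then obtain w where "sol w (\<lambda>k. b k + of_bool (k = i)) (Suc n)"
      by (auto simp: fits_def)
    from sol_add[OF finite_E this g(1)] show ?thesis by (auto simp: fits_def add_ac)
  qed
  ultimately show ?thesis by (auto simp: critical_def)
qed

text \<open>
  For each row \<open>i\<close> the vector with total \<open>n + 2\<close> below \<open>b\<close> raised at \<open>i\<close> may be chosen close to
  \<open>u\<close>. All these vectors then contain the same generator \<open>g\<close>, which can be removed throughout.
\<close>

lemma critical_down:
  assumes "critical b (Suc n)" "card E * proximity < Suc n"
  shows "\<exists>b'. critical b' n"
proof -
  obtain u where u: "sol u b (Suc n)" using assms(1) by (auto simp: critical_def fits_def)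
  obtain g where g: "g \<in> E" "proximity < u g" by (rule large_entry[OF u assms(2)])
  define b' where "b' i = b i - a g i" for i
  have b: "b i = b' i + a g i" if "i \<in> F" for i
  proof -
    have "a g i \<le> b i" using le_of_sol[OF finite_E u g(1) _ that] g(2) by simp
    then show ?thesis by (simp add: b'_def)
  qed
  have "sol u (\<lambda>i. b' i + a g i) (Suc n)" using u sol_cong[of b "\<lambda>i. b' i + a g i"] b by simp
  then have "sol (u(g := u g - 1)) b' n" using g by (intro sol_remove finite_E) auto
  then have "fits b' n" by (auto simp: fits_def)
  moreover have "\<not> fits b' (Suc n)"
  proof
    assume "fits b' (Suc n)"
    then obtain w where "sol w b' (Suc n)" by (auto simp: fits_def)
    then have "sol (w(g := Suc (w g))) b (Suc (Suc n))"
      using sol_add[OF finite_E _ g(1)] sol_cong[of b "\<lambda>i. b' i + a g i"] b by simp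
    then show False using assms(1) by (auto simp: critical_def fits_def)
  qed
  moreover have "fits (\<lambda>k. b' k + of_bool (k = i)) (Suc n)" if i: "i \<in> F" for i
  proof -
    have "fits (\<lambda>k. b k + of_bool (k = i)) (Suc n + 1)"
      using assms(1) i by (simp add: critical_def)
    then obtain w where w: "sol w (\<lambda>k. b k + of_bool (k = i)) (Suc n + 1)"
      by (auto simp: fits_def)
    have "of_bool (k = i) \<le> d" for k using d_pos by simp
    then obtain w'
      where w': "sol w' (\<lambda>k. b k + of_bool (k = i)) (Suc n + 1)" "\<forall>g\<in>E. u g \<le> w' g + proximity"
      using nearby_solution[OF u w] by auto
    have "0 < w' g" using g w'(2) by fastforce
    moreover have "sol w' (\<lambda>k. (b' k + of_bool (k = i)) + a g k) (Suc (Suc n))"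
      using w'(1) sol_cong[of "\<lambda>k. b k + of_bool (k = i)" "\<lambda>k. (b' k + of_bool (k = i)) + a g k"] b
      by simp
    ultimately have "sol (w'(g := w' g - 1)) (\<lambda>k. b' k + of_bool (k = i)) (Suc n)"
      by (intro sol_remove finite_E g(1))
    then show ?thesis by (auto simp: fits_def)
  qed
  ultimately show ?thesis by (auto simp: critical_def)
qed

lemma critical_iff:
  assumes "card E * proximity < m" "m \<le> n"
  shows "(\<exists>b. critical b n) \<longleftrightarrow> (\<exists>b. critical b m)"
  using assms(2)
proof (induction n rule: dec_induct)
  case base
  show ?case ..
next
  case (step k)
  then have "card E * proximity < k" using assms(1) by simp
  then have "(\<exists>b. critical b (Suc k)) \<longleftrightarrow> (\<exists>b. critical b k)"
    using critical_up critical_down by (meson less_SucI)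
  then show ?case using step.IH by simp
qed

end

section \<open>Monomial ideals and their powers\<close>

lemma mpoly_ring_simps [simp]:
  "carrier (mpoly_ring :: ('n, 'k::comm_ring_1) mpolynomial ring) = UNIV"
  "p \<otimes>\<^bsub>(mpoly_ring :: ('n, 'k::comm_ring_1) mpolynomial ring)\<^esub> q = p * q"
  "p \<oplus>\<^bsub>(mpoly_ring :: ('n, 'k::comm_ring_1) mpolynomial ring)\<^esub> q = p + q"
  "\<zero>\<^bsub>(mpoly_ring :: ('n, 'k::comm_ring_1) mpolynomial ring)\<^esub> = 0"
  "\<one>\<^bsub>(mpoly_ring :: ('n, 'k::comm_ring_1) mpolynomial ring)\<^esub> = 1"
  by (simp_all add: ring_of_type_algebra_def)

interpretation mpoly: cring "mpoly_ring :: ('n, 'k::comm_ring_1) mpolynomial ring"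
  by (rule cring_from_type_algebra)

lemma mpoly_a_inv [simp]:
  "\<ominus>\<^bsub>(mpoly_ring :: ('n, 'k::comm_ring_1) mpolynomial ring)\<^esub> p = - p"
  by (rule mpoly.minus_equality) auto

lemma mpoly_ideal_closed:
  fixes P :: "('n, 'k::comm_ring_1) mpolynomial set"
  assumes "ideal P mpoly_ring"
  shows "0 \<in> P" "p \<in> P \<Longrightarrow> q \<in> P \<Longrightarrow> p + q \<in> P" "p \<in> P \<Longrightarrow> q \<in> P \<Longrightarrow> p - q \<in> P"
    "p \<in> P \<Longrightarrow> q * p \<in> P" "p \<in> P \<Longrightarrow> p * q \<in> P"
proof -
  interpret ideal P mpoly_ring by fact
  show 1: "0 \<in> P" using zero_closed by simp
  show 2: "p + q \<in> P" if "p \<in> P" "q \<in> P" for p q using a_closed[OF that] by simp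
  show 3: "q * p \<in> P" if "p \<in> P" for p q using I_l_closed[OF that, of q] by simp
  then show "p * q \<in> P" if "p \<in> P" for p q using that by (simp add: mult.commute)
  show "p - q \<in> P" if "p \<in> P" "q \<in> P" for p q
    using 2[of p "(-1) * q"] 3[of q "-1"] that by simp
qed

lemma mpoly_ideal_sum:
  fixes P :: "('n, 'k::comm_ring_1) mpolynomial set"
  assumes "ideal P mpoly_ring" "\<And>a. a \<in> A \<Longrightarrow> f a \<in> P"
  shows "sum f A \<in> P"
  using assms(2)
  by (induction A rule: infinite_finite_induct) (auto simp: mpoly_ideal_closed[OF assms(1)])

lemma poly_mapping_sum_single:
  "p = (\<Sum>k\<in>Poly_Mapping.keys p. Poly_Mapping.single k (Poly_Mapping.lookup p k))"
proof (rule poly_mapping_eqI)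
  fix e
  show "Poly_Mapping.lookup p e = Poly_Mapping.lookup (\<Sum>k\<in>Poly_Mapping.keys p. Poly_Mapping.single k (Poly_Mapping.lookup p k)) e"
    by (cases "e \<in> Poly_Mapping.keys p")
      (auto simp: lookup_sum lookup_single when_def in_keys_iff)
qed

definition upclosed :: "('n \<Rightarrow>\<^sub>0 nat) set \<Rightarrow> bool" where
  "upclosed U \<longleftrightarrow> (\<forall>e\<in>U. \<forall>f. e + f \<in> U)"

lemma upclosedD: "upclosed U \<Longrightarrow> e \<in> U \<Longrightarrow> e + f \<in> U"
  by (simp add: upclosed_def)

lemma upclosed_add_left: "upclosed U \<Longrightarrow> e \<in> U \<Longrightarrow> f + e \<in> U"
  by (simp add: upclosed_def add.commute)

text \<open>
  For upward closed \<open>U\<close> these are exactly the monomial ideals.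
\<close>

definition supported_on :: "('n \<Rightarrow>\<^sub>0 nat) set \<Rightarrow> ('n, 'k::comm_ring_1) mpolynomial set" where
  "supported_on U = {p. Poly_Mapping.keys p \<subseteq> U}"

lemma single_mem_supported_on_iff [simp]:
  "Poly_Mapping.single e c \<in> supported_on U \<longleftrightarrow> c = 0 \<or> e \<in> U"
  by (simp add: supported_on_def)

lemma ideal_supported_on:
  assumes "upclosed U"
  shows "ideal (supported_on U) (mpoly_ring :: ('n, 'k::comm_ring_1) mpolynomial ring)"
proof (rule idealI)
  show "ring (mpoly_ring :: ('n, 'k) mpolynomial ring)" by (rule mpoly.ring_axioms)
  show "subgroup (supported_on U) (add_monoid (mpoly_ring :: ('n, 'k) mpolynomial ring))"
  proof (rule mpoly.add.subgroupI)
    have "0 \<in> supported_on U" by (simp add: supported_on_def)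
    then show "supported_on U \<noteq> {}" by blast
    show "\<ominus>\<^bsub>mpoly_ring\<^esub> p \<in> supported_on U" if "p \<in> supported_on U" for p :: "('n, 'k) mpolynomial"
      using that by (auto simp: supported_on_def in_keys_iff subset_iff)
    show "p \<oplus>\<^bsub>mpoly_ring\<^esub> q \<in> supported_on U" if "p \<in> supported_on U" "q \<in> supported_on U"
      for p q :: "('n, 'k) mpolynomial"
      using that keys_add[of p q] by (auto simp: supported_on_def)
  qed auto
  fix p q :: "('n, 'k) mpolynomial"
  assume "p \<in> supported_on U"
  then have "{a + b |a b. a \<in> Poly_Mapping.keys q \<and> b \<in> Poly_Mapping.keys p} \<subseteq> U"
    using upclosed_add_left[OF assms] by (auto simp: supported_on_def)
  then have "q * p \<in> supported_on U" using keys_mult[of q p] by (auto simp: supported_on_def)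
  then show "q \<otimes>\<^bsub>mpoly_ring\<^esub> p \<in> supported_on U" "p \<otimes>\<^bsub>mpoly_ring\<^esub> q \<in> supported_on U"
    by (simp_all add: mult.commute)
qed

lemma supported_on_subset_ideal:
  fixes P :: "('n, 'k::comm_ring_1) mpolynomial set"
  assumes "ideal P mpoly_ring" "\<And>e c. e \<in> U \<Longrightarrow> Poly_Mapping.single e c \<in> P"
  shows "supported_on U \<subseteq> P"
proof
  fix p :: "('n, 'k) mpolynomial"
  assume p: "p \<in> supported_on U"
  have "(\<Sum>k\<in>Poly_Mapping.keys p. Poly_Mapping.single k (Poly_Mapping.lookup p k)) \<in> P"
    using p assms(2) by (intro mpoly_ideal_sum[OF assms(1)]) (auto simp: supported_on_def)
  then show "p \<in> P" using poly_mapping_sum_single[of p] by simp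
qed

definition multiples :: "('n \<Rightarrow>\<^sub>0 nat) set \<Rightarrow> ('n \<Rightarrow>\<^sub>0 nat) set" where
  "multiples E = {g + e | g e. g \<in> E}"

lemma upclosed_multiples: "upclosed (multiples E)"
  by (auto simp: upclosed_def multiples_def) (metis add.assoc)

lemma self_in_multiples: "E \<subseteq> multiples E"
  by (auto simp: multiples_def) (metis add.right_neutral)

lemma genideal_monomials:
  "Idl\<^bsub>mpoly_ring\<^esub> ((\<lambda>e. Poly_Mapping.single e (1::'k::comm_ring_1)) ` E) = supported_on (multiples E)"
  (is "Idl\<^bsub>mpoly_ring\<^esub> ?G = _")
proof
  show "Idl\<^bsub>mpoly_ring\<^esub> ?G \<subseteq> supported_on (multiples E)"
    using subsetD[OF self_in_multiples]
    by (intro mpoly.genideal_minimal ideal_supported_on upclosed_multiples) auto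
  have ideal: "ideal (Idl\<^bsub>mpoly_ring\<^esub> ?G) mpoly_ring" by (rule mpoly.genideal_ideal) simp
  show "supported_on (multiples E) \<subseteq> Idl\<^bsub>mpoly_ring\<^esub> ?G"
  proof (rule supported_on_subset_ideal[OF ideal])
    fix e and c :: 'k assume "e \<in> multiples E"
    then obtain g f where gf: "g \<in> E" "e = g + f" by (auto simp: multiples_def)
    have "Poly_Mapping.single g 1 \<in> Idl\<^bsub>mpoly_ring\<^esub> ?G"
      using gf mpoly.genideal_self[of ?G] by auto
    from mpoly_ideal_closed(5)[OF ideal this, of "Poly_Mapping.single f c"]
    show "Poly_Mapping.single e c \<in> Idl\<^bsub>mpoly_ring\<^esub> ?G" using gf by (simp add: mult_single)
  qed
qed

lemma ideal_prod_supported_on: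
  assumes "upclosed U" "upclosed V"
  shows "ideal_prod mpoly_ring (supported_on U) (supported_on V) =
    (supported_on {e + f | e f. e \<in> U \<and> f \<in> V} :: ('n, 'k::comm_ring_1) mpolynomial set)"
    (is "?L = supported_on ?W")
proof
  have "upclosed ?W"
    using assms(2) by (auto simp: upclosed_def) (metis add.assoc)
  then have W: "ideal (supported_on ?W) (mpoly_ring :: ('n, 'k) mpolynomial ring)"
    by (rule ideal_supported_on)
  have L: "ideal ?L (mpoly_ring :: ('n, 'k) mpolynomial ring)"
    by (intro mpoly.ideal_prod_is_ideal ideal_supported_on assms)
  show "?L \<subseteq> supported_on ?W"
  proof
    fix p assume "p \<in> ?L"
    then show "p \<in> supported_on ?W"
    proof (induction p rule: ideal_prod.induct)
      case (prod i j)
      then show ?case using keys_mult[of i j] by (fastforce simp: supported_on_def)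
    next
      case (sum s1 s2)
      then show ?case using mpoly_ideal_closed(2)[OF W] by simp
    qed
  qed
  show "supported_on ?W \<subseteq> ?L"
  proof (rule supported_on_subset_ideal[OF L])
    fix e and c :: 'k assume "e \<in> ?W"
    then obtain u v where uv: "e = u + v" "u \<in> U" "v \<in> V" by blast
    have "Poly_Mapping.single u c \<otimes>\<^bsub>mpoly_ring\<^esub> Poly_Mapping.single v 1 \<in> ?L"
      using uv by (intro ideal_prod.prod) auto
    then show "Poly_Mapping.single e c \<in> ?L" using uv by (simp add: mult_single)
  qed
qed

definition power_exponents :: "('n \<Rightarrow>\<^sub>0 nat) set \<Rightarrow> nat \<Rightarrow> ('n \<Rightarrow>\<^sub>0 nat) set" where
  "power_exponents E n =
     {e. exponents.fits E Poly_Mapping.lookup UNIV (Poly_Mapping.lookup e) n}"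

lemma upclosed_power_exponents: "upclosed (power_exponents E n)"
proof -
  have "exponents.sol E Poly_Mapping.lookup UNIV u (Poly_Mapping.lookup (e + f)) n"
    if "exponents.sol E Poly_Mapping.lookup UNIV u (Poly_Mapping.lookup e) n" for u e f
    using that by (rule exponents.sol_mono) (simp add: lookup_add)
  then show ?thesis by (auto simp: upclosed_def power_exponents_def exponents.fits_def)
qed

text \<open>
  Removing one generator that occurs in a product of \<open>n + 1\<close> generators leaves a product of
  \<open>n\<close> of them.
\<close>

lemma power_exponents_Suc:
  assumes "finite E"
  shows "power_exponents E (Suc n) = {e + f | e f. e \<in> power_exponents E n \<and> f \<in> multiples E}"
proof (intro equalityI subsetI)
  fix x assume "x \<in> power_exponents E (Suc n)"
  then obtain u where u: "exponents.sol E Poly_Mapping.lookup UNIV u (Poly_Mapping.lookup x) (Suc n)"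
    by (auto simp: power_exponents_def exponents.fits_def)
  have "\<exists>g\<in>E. 0 < u g"
  proof (rule ccontr)
    assume "\<not> ?thesis"
    then have "(\<Sum>g\<in>E. u g) = 0" by (intro sum.neutral) auto
    then show False using u by (simp add: exponents.sol_def)
  qed
  then obtain g where g: "g \<in> E" "0 < u g" by blast
  have le: "Poly_Mapping.lookup g i \<le> Poly_Mapping.lookup x i" for i
    using exponents.le_of_sol[OF assms u g] by simp
  then have x: "x = (x - g) + g" by (intro poly_mapping_eqI) (simp add: lookup_add lookup_minus)
  have "exponents.sol E Poly_Mapping.lookup UNIV u
    (\<lambda>i. Poly_Mapping.lookup (x - g) i + Poly_Mapping.lookup g i) (Suc n)"
    using u le by (simp add: lookup_minus)
  from exponents.sol_remove[OF assms this g]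
  have "x - g \<in> power_exponents E n" by (auto simp: power_exponents_def exponents.fits_def)
  moreover have "g \<in> multiples E" using g(1) self_in_multiples by blast
  ultimately show "x \<in> {e + f | e f. e \<in> power_exponents E n \<and> f \<in> multiples E}" using x by blast
next
  fix x assume "x \<in> {e + f | e f. e \<in> power_exponents E n \<and> f \<in> multiples E}"
  then obtain e g f where x: "x = e + (g + f)" "e \<in> power_exponents E n" "g \<in> E"
    by (auto simp: multiples_def)
  from x(2) obtain u where "exponents.sol E Poly_Mapping.lookup UNIV u (Poly_Mapping.lookup e) n"
    by (auto simp: power_exponents_def exponents.fits_def)
  from exponents.sol_add[OF assms this x(3)]
  have "e + g \<in> power_exponents E (Suc n)"
    by (auto simp: power_exponents_def exponents.fits_def plus_poly_mapping.rep_eq)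
  then have "(e + g) + f \<in> power_exponents E (Suc n)" by (rule upclosedD[OF upclosed_power_exponents])
  then show "x \<in> power_exponents E (Suc n)" using x(1) by (simp add: add.assoc)
qed

lemma power_supported_on:
  assumes "finite E"
  shows "(supported_on (multiples E) :: ('n, 'k::comm_ring_1) mpolynomial set)
      [^]\<^bsub>ideals_set mpoly_ring\<^esub> (n::nat) = supported_on (power_exponents E n)"
proof (induction n)
  case 0
  have "power_exponents E 0 = UNIV"
    by (auto simp: power_exponents_def exponents.fits_def exponents.sol_def intro: exI[of _ "\<lambda>_. 0"])
  then show ?case by (simp add: nat_pow_def ideals_set_def supported_on_def)
next
  case (Suc n)
  have "(supported_on (multiples E) :: ('n, 'k) mpolynomial set) [^]\<^bsub>ideals_set mpoly_ring\<^esub> Suc n =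
    ideal_prod mpoly_ring (supported_on (multiples E) [^]\<^bsub>ideals_set mpoly_ring\<^esub> n) (supported_on (multiples E))"
    by (simp add: nat_pow_def ideals_set_def)
  also have "\<dots> = ideal_prod mpoly_ring (supported_on (power_exponents E n)) (supported_on (multiples E))"
    by (simp only: Suc.IH)
  also have "\<dots> = supported_on (power_exponents E (Suc n))"
    by (simp add: ideal_prod_supported_on upclosed_power_exponents upclosed_multiples power_exponents_Suc[OF assms])
  finally show ?case .
qed

text \<open>
  Every element of \<open>I / J\<close> is the class of some \<open>f\<close> in \<open>I\<close>, and its annihilator is the colon
  ideal of \<open>f\<close> into \<open>J\<close>.
\<close>

lemma associated_primes_quotient_iff:
  assumes "cring R" "ideal I R" "ideal J R" "J \<subseteq> I"
  shows "P \<in> associated_primes R (quotient_module (ideal_module R I) J) \<longleftrightarrow>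
    primeideal P R \<and> (\<exists>f\<in>I. P = {a \<in> carrier R. a \<otimes>\<^bsub>R\<^esub> f \<in> J})"
proof -
  let ?M = "ideal_module R I"
  have M: "module R ?M" and N: "submodule J R ?M"
    using assms by (auto intro: module_ideal_module submodule_ideal_module)
  interpret M: module R ?M by (rule M)
  interpret N: submodule J R ?M by (rule N)
  interpret A: abelian_subgroup J ?M
    by (rule abelian_subgroupI3)
       (auto intro!: additive_subgroup.intro N.subgroup_axioms M.abelian_group_axioms)
  have car: "carrier (quotient_module ?M J) = (\<lambda>f. J +>\<^bsub>?M\<^esub> f) ` I"
    by (auto simp: quotient_module_def A_RCOSETS_def' ideal_module_def)
  have ann: "annihilator R (quotient_module ?M J) (J +>\<^bsub>?M\<^esub> f) = {a \<in> carrier R. a \<otimes>\<^bsub>R\<^esub> f \<in> J}"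
    if f: "f \<in> I" for f
  proof -
    have "a \<odot>\<^bsub>quotient_module ?M J\<^esub> (J +>\<^bsub>?M\<^esub> f) = J \<longleftrightarrow> a \<otimes>\<^bsub>R\<^esub> f \<in> J" if a: "a \<in> carrier R" for a
    proof -
      have f': "f \<in> carrier ?M" using f by (simp add: ideal_module_def)
      have eq: "a \<odot>\<^bsub>quotient_module ?M J\<^esub> (J +>\<^bsub>?M\<^esub> f) = J +>\<^bsub>?M\<^esub> (a \<otimes>\<^bsub>R\<^esub> f)"
        using quotient_module_smult_coset[OF M N a f'] by (simp add: ideal_module_def)
      have "a \<otimes>\<^bsub>R\<^esub> f \<in> carrier ?M" using M.smult_closed[OF a f'] by (simp add: ideal_module_def)
      then have "a \<otimes>\<^bsub>R\<^esub> f \<in> J +>\<^bsub>?M\<^esub> (a \<otimes>\<^bsub>R\<^esub> f)" by (rule A.a_rcos_self)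
      then show ?thesis using A.a_rcos_const eq by metis
    qed
    then show ?thesis by (auto simp: annihilator_def) (auto simp: quotient_module_def)
  qed
  show ?thesis using ann by (auto simp: associated_primes_def car)
qed


section \<open>Primes that annihilate a residue class modulo a monomial ideal\<close>

definition part :: "('n \<Rightarrow>\<^sub>0 nat) set \<Rightarrow> ('n, 'k::comm_ring_1) mpolynomial \<Rightarrow> ('n, 'k) mpolynomial" where
  "part S p = (\<Sum>e\<in>Poly_Mapping.keys p \<inter> S. Poly_Mapping.single e (Poly_Mapping.lookup p e))"

lemma lookup_part: "Poly_Mapping.lookup (part S p) e = (if e \<in> S then Poly_Mapping.lookup p e else 0)"
proof -
  have "Poly_Mapping.lookup (part S p) e =
    (\<Sum>k\<in>Poly_Mapping.keys p \<inter> S. if k = e then Poly_Mapping.lookup p e else 0)"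
    unfolding part_def lookup_sum by (intro sum.cong) (auto simp: lookup_single when_def)
  then show ?thesis by (simp add: sum.delta' in_keys_iff)
qed

lemma keys_part: "Poly_Mapping.keys (part S p) = Poly_Mapping.keys p \<inter> S"
  by (auto simp: in_keys_iff lookup_part split: if_splits)

lemma part_part: "part S (part T p) = part (S \<inter> T) p"
  by (rule poly_mapping_eqI) (simp add: lookup_part)

lemma part_UNIV: "part UNIV p = p"
  by (rule poly_mapping_eqI) (simp add: lookup_part)

lemma part_singleton: "part {e} p = Poly_Mapping.single e (Poly_Mapping.lookup p e)"
  by (rule poly_mapping_eqI) (simp add: lookup_part lookup_single when_def)

definition component :: "(('n \<Rightarrow>\<^sub>0 nat) \<Rightarrow> nat) \<Rightarrow> nat \<Rightarrow> ('n, 'k::comm_ring_1) mpolynomial \<Rightarrow> ('n, 'k) mpolynomial" where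
  "component w k p = part {e. w e = k} p"

lemma one_notin_prime:
  assumes "primeideal P (mpoly_ring :: ('n, 'k::comm_ring_1) mpolynomial ring)"
  shows "1 \<notin> P"
proof
  interpret primeideal P "mpoly_ring :: ('n, 'k) mpolynomial ring" by fact
  assume "1 \<in> P"
  then show False using one_imp_carrier I_notcarr by simp
qed

lemma prime_mult:
  assumes "primeideal P (mpoly_ring :: ('n, 'k::comm_ring_1) mpolynomial ring)"
  shows "p * q \<in> P \<longleftrightarrow> p \<in> P \<or> q \<in> P"
proof -
  interpret primeideal P "mpoly_ring :: ('n, 'k) mpolynomial ring" by fact
  show ?thesis
    using I_prime[of p q] mpoly_ideal_closed(4,5)[OF ideal_axioms] by auto
qed

text \<open>
  The top components of \<open>p\<close> and of \<open>f\<close> modulo the monomial ideal multiply to the top component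
  of \<open>p * f\<close>, which is zero modulo the ideal. So multiplying \<open>f\<close> by the top component of \<open>p\<close>
  destroys the top weight of \<open>f\<close> and shifts the others.
\<close>

lemma top_component_product_weights:
  fixes f p :: "('n, 'k::comm_ring_1) mpolynomial"
  assumes w: "\<And>a b. w (a + b) = w a + w b" and U: "upclosed U"
    and pf: "p * f \<in> supported_on U" and p: "p \<noteq> 0" and f: "\<not> Poly_Mapping.keys f \<subseteq> U"
  defines "M \<equiv> Max (w ` Poly_Mapping.keys p)"
  shows "card (w ` (Poly_Mapping.keys (component w M p * f) - U)) < card (w ` (Poly_Mapping.keys f - U))"
proof -
  define W where "W = w ` (Poly_Mapping.keys f - U)"
  define m where "m = Max W"
  define q where "q = component w M p"
  have W: "finite W" "W \<noteq> {}" using f by (auto simp: W_def)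
  then have m: "m \<in> W" by (simp add: m_def)
  have keys_q: "w a = M" if "a \<in> Poly_Mapping.keys q" for a
    using that by (simp add: q_def component_def keys_part)
  have keys_rest: "w a < M" if "a \<in> Poly_Mapping.keys (p - q)" for a
  proof -
    have "a \<in> Poly_Mapping.keys p" "w a \<noteq> M"
      using that by (auto simp: in_keys_iff lookup_minus q_def component_def lookup_part split: if_splits)
    then show ?thesis unfolding M_def by (metis Max_ge finite_imageI finite_keys imageI le_neq_implies_less)
  qed
  have factor: "b \<in> Poly_Mapping.keys f - U \<Longrightarrow> w b \<in> W" for b by (simp add: W_def)
  have notU: "b \<notin> U" if "a + b \<notin> U" for a b
    using that upclosed_add_left[OF U] by blast
  have "w e \<in> (+) M ` (W - {m})" if e: "e \<in> Poly_Mapping.keys (q * f) - U" for e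
  proof -
    obtain a b where ab: "e = a + b" "a \<in> Poly_Mapping.keys q" "b \<in> Poly_Mapping.keys f"
      using e keys_mult[of q f] by blast
    have b: "w b \<in> W" using ab e notU by (intro factor) blast
    have "e \<notin> Poly_Mapping.keys (p * f)" using e pf by (auto simp: supported_on_def)
    moreover have "p * f = (p - q) * f + q * f" by (simp add: algebra_simps)
    ultimately have "e \<in> Poly_Mapping.keys ((p - q) * f)"
      using e by (auto simp: in_keys_iff lookup_add)
    then obtain a' b' where ab': "e = a' + b'" "a' \<in> Poly_Mapping.keys (p - q)" "b' \<in> Poly_Mapping.keys f"
      using keys_mult[of "p - q" f] by blast
    have "w b' \<in> W" using ab' e notU by (intro factor) blast
    then have "w b' \<le> m" using W(1) by (simp add: m_def)
    then have "w e < M + m" using keys_rest[OF ab'(2)] ab'(1) w by simp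
    then have "w b \<noteq> m" using keys_q[OF ab(2)] ab(1) w by simp
    then show ?thesis using b keys_q[OF ab(2)] ab(1) w by auto
  qed
  then have "card (w ` (Poly_Mapping.keys (q * f) - U)) \<le> card ((+) M ` (W - {m}))"
    using W by (intro card_mono) auto
  also have "\<dots> \<le> card (W - {m})" using W by (intro card_image_le) simp
  also have "\<dots> < card W" using W m by (intro card_Diff1_less)
  finally show ?thesis by (simp add: W_def q_def)
qed

text \<open>
  The annihilator of an element of a graded module is homogeneous if it is prime. Let \<open>q\<close> be
  the top component of \<open>p \<in> P\<close>. If \<open>q \<in> P\<close>, the components of \<open>p - q\<close> are treated by
  induction. Otherwise \<open>P\<close> is also the annihilator of \<open>q * f\<close>, because \<open>P\<close> is prime, and
  \<open>q * f\<close> has fewer weights modulo the monomial ideal than \<open>f\<close>. An arbitrary weight function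
  is allowed, since it is applied to the degree in each variable separately.
\<close>

lemma component_mem_prime_colon:
  fixes f p :: "('n, 'k::comm_ring_1) mpolynomial"
  assumes w: "\<And>a b. w (a + b) = w a + w b" and U: "upclosed U"
    and prime: "primeideal P mpoly_ring"
    and P: "P = {p. p * f \<in> supported_on U}" and p: "p \<in> P"
  shows "component w k p \<in> P"
  using P p
proof (induction "card (w ` (Poly_Mapping.keys f - U))" arbitrary: f p k rule: less_induct)
  case outer: less
  have ideal: "ideal P mpoly_ring" using prime by (rule primeideal.axioms(1))
  have Uideal: "ideal (supported_on U) (mpoly_ring :: ('n, 'k) mpolynomial ring)"
    using U by (rule ideal_supported_on)
  have f: "\<not> Poly_Mapping.keys f \<subseteq> U"
    using outer.prems(1) one_notin_prime[OF prime] by (auto simp: supported_on_def)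
  show ?case using outer.prems(2)
  proof (induction "card (w ` Poly_Mapping.keys p)" arbitrary: p k rule: less_induct)
    case inner: less
    show ?case
    proof (cases "p = 0")
      case True
      then show ?thesis using mpoly_ideal_closed(1)[OF ideal] by (simp add: component_def part_def)
    next
      case False
      define M where "M = Max (w ` Poly_Mapping.keys p)"
      define q where "q = component w M p"
      have pf: "p * f \<in> supported_on U" using inner.prems outer.prems(1) by simp
      show ?thesis
      proof (cases "q \<in> P")
        case True
        have keys: "Poly_Mapping.keys (p - q) = Poly_Mapping.keys p - {e. w e = M}"
          by (auto simp: in_keys_iff lookup_minus q_def component_def lookup_part split: if_splits)
        have "M \<in> w ` Poly_Mapping.keys p" unfolding M_def using False by (intro Max_in) auto
        moreover have "M \<notin> w ` Poly_Mapping.keys (p - q)" by (auto simp: keys)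
        ultimately have "w ` Poly_Mapping.keys (p - q) \<subset> w ` Poly_Mapping.keys p"
          by (auto simp: keys)
        then have "card (w ` Poly_Mapping.keys (p - q)) < card (w ` Poly_Mapping.keys p)"
          by (intro psubset_card_mono) auto
        from inner.hyps[OF this mpoly_ideal_closed(3)[OF ideal inner.prems True], of k]
        have "component w k (p - q) \<in> P" .
        moreover have "component w k p = (if k = M then q else component w k (p - q))"
          by (auto intro!: poly_mapping_eqI simp: component_def q_def lookup_part lookup_minus)
        ultimately show ?thesis using True by simp
      next
        case False
        have "P = {r. r * (q * f) \<in> supported_on U}"
        proof (intro equalityI subsetI CollectI)
          fix r assume "r \<in> P"
          then have "q * (r * f) \<in> supported_on U"
            using outer.prems(1) mpoly_ideal_closed(4)[OF Uideal] by simp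
          then show "r * (q * f) \<in> supported_on U" by (simp add: mult_ac)
        next
          fix r assume "r \<in> {r. r * (q * f) \<in> supported_on U}"
          then have "(r * q) * f \<in> supported_on U" by (simp add: mult_ac)
          then have "r * q \<in> P" using outer.prems(1) by simp
          then show "r \<in> P" using prime_mult[OF prime] False by simp
        qed
        then show ?thesis
          using outer.hyps[of "q * f" p k] top_component_product_weights[OF w U pf \<open>p \<noteq> 0\<close> f]
            inner.prems by (simp add: q_def M_def)
      qed
    qed
  qed
qed

text \<open>
  A single term of \<open>p\<close> is cut out by fixing the degree in one variable after the other.
\<close>

lemma monomials_mem_prime_colon:
  fixes f p :: "('n::finite, 'k::field) mpolynomial"
  assumes U: "upclosed U" and prime: "primeideal P mpoly_ring"
    and P: "P = {p. p * f \<in> supported_on U}" and p: "p \<in> P" and e: "e \<in> Poly_Mapping.keys p"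
  shows "Poly_Mapping.single e 1 \<in> P"
proof -
  have ideal: "ideal P mpoly_ring" using prime by (rule primeideal.axioms(1))
  define S where "S A = {k. \<forall>i\<in>A. Poly_Mapping.lookup k i = Poly_Mapping.lookup e i}" for A
  have "part (S A) p \<in> P" if "finite A" for A
    using that
  proof (induction A)
    case empty
    then show ?case using p by (simp add: S_def part_UNIV)
  next
    case (insert i A)
    have "component (\<lambda>k. Poly_Mapping.lookup k i) (Poly_Mapping.lookup e i) (part (S A) p) \<in> P"
      by (rule component_mem_prime_colon[OF _ U prime P insert.IH]) (simp add: lookup_add)
    moreover have "{k. Poly_Mapping.lookup k i = Poly_Mapping.lookup e i} \<inter> S A = S (insert i A)"
      by (auto simp: S_def)
    ultimately show ?case by (simp add: component_def part_part)
  qed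
  from this[of UNIV] have "part (S UNIV) p \<in> P" by simp
  moreover have "S UNIV = {e}" by (auto simp: S_def intro: poly_mapping_eqI)
  ultimately have "Poly_Mapping.single e (Poly_Mapping.lookup p e) \<in> P" by (simp add: part_singleton)
  from mpoly_ideal_closed(4)[OF ideal this, of "Poly_Mapping.single 0 (inverse (Poly_Mapping.lookup p e))"]
  show ?thesis using e by (simp add: mult_single in_keys_iff)
qed

lemma lookup_times_monomial:
  fixes p :: "('n, 'k::comm_ring_1) mpolynomial"
  shows "Poly_Mapping.lookup (p * Poly_Mapping.single b 1) (e + b) = Poly_Mapping.lookup p e"
proof -
  have "p * Poly_Mapping.single b 1 =
    (\<Sum>k\<in>Poly_Mapping.keys p. Poly_Mapping.single (k + b) (Poly_Mapping.lookup p k))"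
    by (subst (1) poly_mapping_sum_single[of p]) (simp add: sum_distrib_right mult_single)
  then have "Poly_Mapping.lookup (p * Poly_Mapping.single b 1) (e + b) =
    (\<Sum>k\<in>Poly_Mapping.keys p. if k = e then Poly_Mapping.lookup p e else 0)"
    by (auto simp: lookup_sum lookup_single when_def intro!: sum.cong)
  then show ?thesis by (simp add: sum.delta' in_keys_iff)
qed

lemma times_monomial_mem_iff:
  fixes p :: "('n, 'k::comm_ring_1) mpolynomial"
  shows "p * Poly_Mapping.single b 1 \<in> supported_on U \<longleftrightarrow> p \<in> supported_on {e. e + b \<in> U}"
proof -
  have "Poly_Mapping.keys (p * Poly_Mapping.single b 1) = (\<lambda>e. e + b) ` Poly_Mapping.keys p"
  proof
    show "Poly_Mapping.keys (p * Poly_Mapping.single b 1) \<subseteq> (\<lambda>e. e + b) ` Poly_Mapping.keys p"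
      using keys_mult[of p "Poly_Mapping.single b 1"] by auto
    show "(\<lambda>e. e + b) ` Poly_Mapping.keys p \<subseteq> Poly_Mapping.keys (p * Poly_Mapping.single b 1)"
      by (auto simp: in_keys_iff lookup_times_monomial)
  qed
  then show ?thesis by (auto simp: supported_on_def)
qed

text \<open>
  The prime \<open>P\<close> is the intersection of the colon ideals of the monomials of \<open>f\<close>, since it
  contains with a polynomial all its monomials. A prime that is a finite intersection of
  ideals is one of them.
\<close>

lemma prime_colon_monomial:
  fixes f :: "('n::finite, 'k::field) mpolynomial"
  assumes U: "upclosed U" and prime: "primeideal P mpoly_ring"
    and P: "P = {p. p * f \<in> supported_on U}"
  shows "\<exists>b\<in>Poly_Mapping.keys f. P = {p. p * Poly_Mapping.single b 1 \<in> supported_on U}"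
proof (rule ccontr)
  assume none: "\<not> ?thesis"
  have ideal: "ideal P mpoly_ring" using prime by (rule primeideal.axioms(1))
  have Uideal: "ideal (supported_on U) (mpoly_ring :: ('n, 'k) mpolynomial ring)"
    using U by (rule ideal_supported_on)
  have sub: "P \<subseteq> {p. p * Poly_Mapping.single b 1 \<in> supported_on U}"
    if b: "b \<in> Poly_Mapping.keys f" for b
  proof
    fix p assume p: "p \<in> P"
    have "e + b \<in> U" if "e \<in> Poly_Mapping.keys p" for e
    proof -
      have "f * Poly_Mapping.single e 1 \<in> supported_on U"
        using monomials_mem_prime_colon[OF U prime P p that] P by (simp add: mult.commute)
      then have "f \<in> supported_on {k. k + e \<in> U}" by (simp only: times_monomial_mem_iff)
      then show ?thesis using b by (auto simp: supported_on_def add.commute)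
    qed
    then show "p \<in> {p. p * Poly_Mapping.single b 1 \<in> supported_on U}"
      unfolding mem_Collect_eq times_monomial_mem_iff by (auto simp: supported_on_def)
  qed
  have "\<exists>p. p * Poly_Mapping.single b 1 \<in> supported_on U \<and> p \<notin> P" if "b \<in> Poly_Mapping.keys f" for b
    using sub[OF that] none that by blast
  then obtain g where g: "\<And>b. b \<in> Poly_Mapping.keys f \<Longrightarrow> g b * Poly_Mapping.single b 1 \<in> supported_on U"
    "\<And>b. b \<in> Poly_Mapping.keys f \<Longrightarrow> g b \<notin> P"
    by metis
  \<comment> \<open>A product of elements g b outside P, one from each colon ideal: it would lie in P.\<close>
  define h where "h = (\<Prod>b\<in>Poly_Mapping.keys f. g b)"
  have "(\<Prod>b\<in>A. g b) \<notin> P" if "finite A" "A \<subseteq> Poly_Mapping.keys f" for A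
    using that
    by (induction A) (auto simp: one_notin_prime[OF prime] prime_mult[OF prime] g(2))
  then have "h \<notin> P" by (simp add: h_def)
  have "h * Poly_Mapping.single b c \<in> supported_on U" if b: "b \<in> Poly_Mapping.keys f" for b c
  proof -
    have "h = (\<Prod>b\<in>Poly_Mapping.keys f - {b}. g b) * g b"
      unfolding h_def using b by (subst prod.remove[of _ b]) (auto simp: mult.commute)
    moreover have "Poly_Mapping.single b c = Poly_Mapping.single 0 c * Poly_Mapping.single b 1"
      by (simp add: mult_single)
    ultimately have "h * Poly_Mapping.single b c =
      ((\<Prod>b\<in>Poly_Mapping.keys f - {b}. g b) * Poly_Mapping.single 0 c) * (g b * Poly_Mapping.single b 1)"
      by (simp only: mult_ac)
    then show ?thesis using mpoly_ideal_closed(4)[OF Uideal g(1)[OF b]] by simp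
  qed
  then have "(\<Sum>b\<in>Poly_Mapping.keys f. h * Poly_Mapping.single b (Poly_Mapping.lookup f b)) \<in> supported_on U"
    by (intro mpoly_ideal_sum[OF Uideal])
  then have "h * f \<in> supported_on U"
    using poly_mapping_sum_single[of f] by (simp flip: sum_distrib_left)
  then show False using \<open>h \<notin> P\<close> P by simp
qed

text \<open>
  The exponents of the monomials in the prime generated by the variables in \<open>F\<close>.
\<close>

definition meets :: "'n set \<Rightarrow> ('n \<Rightarrow>\<^sub>0 nat) set" where
  "meets F = {e. \<exists>i\<in>F. 0 < Poly_Mapping.lookup e i}"

text \<open>
  A monomial in a prime ideal is a product of variables, so one of these lies in the ideal.
\<close>

lemma monomial_prime:
  fixes P :: "('n::finite, 'k::field) mpolynomial set"
  assumes prime: "primeideal P mpoly_ring" and P: "P = supported_on V"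
  shows "\<exists>F. V = meets F"
proof -
  define F where "F = {i. Poly_Mapping.single i 1 \<in> V}"
  have mem: "e \<in> V \<longleftrightarrow> Poly_Mapping.single e 1 \<in> P" for e using P by simp
  have add: "e + f \<in> V \<longleftrightarrow> e \<in> V \<or> f \<in> V" for e f
    using prime_mult[OF prime, of "Poly_Mapping.single e 1" "Poly_Mapping.single f 1"]
    by (simp add: mem mult_single)
  have zero: "0 \<notin> V" using one_notin_prime[OF prime] by (simp add: mem)
  have "e \<in> V \<longleftrightarrow> e \<in> meets F" for e
  proof (induction "\<Sum>i\<in>UNIV. Poly_Mapping.lookup e i" arbitrary: e rule: less_induct)
    case less
    show ?case
    proof (cases "e = 0")
      case True
      then show ?thesis using zero by (simp add: meets_def)
    next
      case False
      then obtain i where i: "0 < Poly_Mapping.lookup e i"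
        by (metis gr0I lookup_zero poly_mapping_eqI)
      define f where "f = e - Poly_Mapping.single i 1"
      have e: "e = f + Poly_Mapping.single i 1"
        using i by (intro poly_mapping_eqI) (auto simp: f_def lookup_add lookup_minus lookup_single when_def)
      have "(\<Sum>j\<in>UNIV. Poly_Mapping.lookup f j) < (\<Sum>j\<in>UNIV. Poly_Mapping.lookup e j)"
        unfolding e by (intro sum_strict_mono_ex1) (auto simp: lookup_add intro!: exI[of _ i])
      then have "f \<in> V \<longleftrightarrow> f \<in> meets F" by (rule less)
      then show ?thesis unfolding e add
        by (auto simp: F_def meets_def lookup_add lookup_single when_def split: if_splits)
    qed
  qed
  then show ?thesis by blast
qed

lemma associated_primes_iff:
  fixes P :: "('n::finite, 'k::field) mpolynomial set"
  assumes U: "upclosed U" and V: "upclosed V" and VU: "V \<subseteq> U"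
  shows "P \<in> associated_primes mpoly_ring
      (quotient_module (ideal_module mpoly_ring (supported_on U)) (supported_on V)) \<longleftrightarrow>
    primeideal P mpoly_ring \<and>
    (\<exists>F. P = supported_on (meets F) \<and> (\<exists>b\<in>U. {e. e + b \<in> V} = meets F))"
    (is "?L \<longleftrightarrow> ?R")
proof -
  have sub: "supported_on V \<subseteq> (supported_on U :: ('n, 'k) mpolynomial set)"
    using VU by (auto simp: supported_on_def)
  have iff: "?L \<longleftrightarrow> primeideal P mpoly_ring \<and>
    (\<exists>f\<in>supported_on U. P = {p. p * f \<in> supported_on V})"
    using associated_primes_quotient_iff[OF mpoly.is_cring ideal_supported_on[OF U] ideal_supported_on[OF V] sub]
    by simp
  have colon: "{p. p * Poly_Mapping.single b 1 \<in> supported_on V} = (supported_on {e. e + b \<in> V} :: ('n, 'k) mpolynomial set)" for b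
    by (auto simp: times_monomial_mem_iff)
  show ?thesis
  proof
    assume ?L
    then obtain f where prime: "primeideal P mpoly_ring" and f: "f \<in> supported_on U"
      "P = {p. p * f \<in> supported_on V}" unfolding iff by blast
    obtain b where b: "b \<in> Poly_Mapping.keys f" "P = supported_on {e. e + b \<in> V}"
      using prime_colon_monomial[OF V prime f(2)] unfolding colon by blast
    obtain F where F: "{e. e + b \<in> V} = meets F" using monomial_prime[OF prime b(2)] by blast
    have "b \<in> U" using b(1) f(1) by (auto simp: supported_on_def)
    then show ?R using prime b(2) F by auto
  next
    assume ?R
    then obtain F b where F: "P = supported_on (meets F)" "{e. e + b \<in> V} = meets F"
      and prime: "primeideal P mpoly_ring" and b: "b \<in> U" by blast
    then have "P = supported_on {e. e + b \<in> V}" by simp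
    with prime b have "primeideal P mpoly_ring" "P = supported_on {e. e + b \<in> V}" "b \<in> U" by simp_all
    then show ?L unfolding iff
      by (auto simp: times_monomial_mem_iff intro!: bexI[of _ "Poly_Mapping.single b 1"])
  qed
qed


section \<open>Associated primes as critical points\<close>

lemma power_exponents_decreasing:
  assumes "finite E"
  shows "power_exponents E (Suc n) \<subseteq> power_exponents E n"
  using upclosedD[OF upclosed_power_exponents] by (auto simp: power_exponents_Suc[OF assms])

lemma exponents_sol_superset:
  assumes "exponents.sol E a F u b n" "\<And>i. i \<in> F' - F \<Longrightarrow> (\<Sum>g\<in>E. u g * a g i) \<le> b i"
  shows "exponents.sol E a F' u b n"
  using assms by (auto simp: exponents.sol_def)

text \<open>
  Restricting to the rows in \<open>F\<close> corresponds to inverting the remaining variables. Conversely a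
  critical \<open>b\<close> on \<open>F\<close> is extended by entries outside \<open>F\<close> that are so large that no sum of at
  most \<open>n + 1\<close> exponents of generators exceeds them.
\<close>

lemma colon_power_exponents_iff_critical:
  fixes E :: "('n::finite \<Rightarrow>\<^sub>0 nat) set"
  assumes "finite E"
  shows "(\<exists>b\<in>power_exponents E n. {e. e + b \<in> power_exponents E (Suc n)} = meets F) \<longleftrightarrow>
    (\<exists>b. exponents.critical E Poly_Mapping.lookup F b n)"
proof
  assume "\<exists>b\<in>power_exponents E n. {e. e + b \<in> power_exponents E (Suc n)} = meets F"
  then obtain b where b: "b \<in> power_exponents E n"
    "\<And>e. e + b \<in> power_exponents E (Suc n) \<longleftrightarrow> e \<in> meets F" by blast
  have restrict: "exponents.fits E Poly_Mapping.lookup F c m"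
    if "exponents.fits E Poly_Mapping.lookup UNIV c m" for c m
    using that by (auto simp: exponents.fits_def exponents.sol_def)
  have "exponents.critical E Poly_Mapping.lookup F (Poly_Mapping.lookup b) n"
    unfolding exponents.critical_def
  proof (intro conjI ballI notI)
    show "exponents.fits E Poly_Mapping.lookup F (Poly_Mapping.lookup b) n"
      using b(1) by (auto simp: power_exponents_def intro: restrict)
  next
    assume "exponents.fits E Poly_Mapping.lookup F (Poly_Mapping.lookup b) (Suc n)"
    then obtain u where u: "exponents.sol E Poly_Mapping.lookup F u (Poly_Mapping.lookup b) (Suc n)"
      by (auto simp: exponents.fits_def)
    \<comment> \<open>Multiplying by this monomial, free of the variables in F, would reach the next power.\<close>
    define f where "f i = (if i \<in> F then 0 else \<Sum>g\<in>E. u g * Poly_Mapping.lookup g i)" for i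
    define e where "e = Abs_poly_mapping f"
    have e: "Poly_Mapping.lookup e = f" by (simp add: e_def)
    have "exponents.sol E Poly_Mapping.lookup UNIV u (Poly_Mapping.lookup (e + b)) (Suc n)"
      using u by (auto simp: exponents.sol_def lookup_add e f_def)
    then have "e \<in> meets F" using b(2) by (auto simp: power_exponents_def exponents.fits_def)
    then show False by (auto simp: meets_def e f_def)
  next
    fix i assume "i \<in> F"
    then have "Poly_Mapping.single i 1 \<in> meets F" by (auto simp: meets_def intro!: bexI[of _ i])
    then have "exponents.fits E Poly_Mapping.lookup UNIV
      (Poly_Mapping.lookup (Poly_Mapping.single i 1 + b)) (Suc n)"
      using b(2) by (simp add: power_exponents_def)
    moreover have "Poly_Mapping.lookup (Poly_Mapping.single i 1 + b) =
      (\<lambda>k. Poly_Mapping.lookup b k + of_bool (k = i))"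
      by (auto simp: fun_eq_iff lookup_add lookup_single when_def)
    ultimately show "exponents.fits E Poly_Mapping.lookup F
      (\<lambda>k. Poly_Mapping.lookup b k + of_bool (k = i)) (Suc n)"
      using restrict by simp
  qed
  then show "\<exists>b. exponents.critical E Poly_Mapping.lookup F b n" by blast
next
  assume "\<exists>b. exponents.critical E Poly_Mapping.lookup F b n"
  then obtain b where crit: "exponents.critical E Poly_Mapping.lookup F b n" by blast
  define D where "D = (\<Sum>g\<in>E. \<Sum>i\<in>UNIV. Poly_Mapping.lookup g i)"
  define f where "f i = (if i \<in> F then b i else Suc n * D)" for i
  define c where "c = Abs_poly_mapping f"
  have c: "Poly_Mapping.lookup c = f" by (simp add: c_def)
  have small: "(\<Sum>g\<in>E. u g * Poly_Mapping.lookup g i) \<le> Suc n * D"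
    if "(\<Sum>g\<in>E. u g) \<le> Suc n" for u i
  proof -
    have "Poly_Mapping.lookup g i \<le> D" if "g \<in> E" for g
    proof -
      have "Poly_Mapping.lookup g i \<le> (\<Sum>i\<in>UNIV. Poly_Mapping.lookup g i)"
        by (intro member_le_sum) auto
      also have "\<dots> \<le> D" unfolding D_def using that assms
        by (intro member_le_sum[where f = "\<lambda>g. \<Sum>i\<in>UNIV. Poly_Mapping.lookup g i"]) auto
      finally show ?thesis .
    qed
    then have "(\<Sum>g\<in>E. u g * Poly_Mapping.lookup g i) \<le> (\<Sum>g\<in>E. u g * D)"
      by (intro sum_mono) simp
    also have "\<dots> = (\<Sum>g\<in>E. u g) * D" by (simp add: sum_distrib_right)
    also have "\<dots> \<le> Suc n * D" using that by (rule mult_le_mono1)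
    finally show ?thesis .
  qed
  have extend: "e + c \<in> power_exponents E m"
    if "exponents.sol E Poly_Mapping.lookup F u b' m" "m \<le> Suc n"
      "\<And>i. i \<in> F \<Longrightarrow> b' i \<le> Poly_Mapping.lookup e i + b i" for e u b' m
  proof -
    have "exponents.sol E Poly_Mapping.lookup F u (Poly_Mapping.lookup (e + c)) m"
      using that by (auto simp: lookup_add c f_def intro: exponents.sol_mono)
    moreover have "(\<Sum>g\<in>E. u g * Poly_Mapping.lookup g i) \<le> Poly_Mapping.lookup (e + c) i"
      if "i \<in> UNIV - F" for i
    proof -
      have "(\<Sum>g\<in>E. u g) \<le> Suc n"
        using \<open>exponents.sol _ _ F u b' m\<close> \<open>m \<le> Suc n\<close> by (simp add: exponents.sol_def)
      then show ?thesis using small[of u i] that by (simp add: lookup_add c f_def)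
    qed
    ultimately have "exponents.sol E Poly_Mapping.lookup UNIV u (Poly_Mapping.lookup (e + c)) m"
      by (rule exponents_sol_superset)
    then show ?thesis by (auto simp: power_exponents_def exponents.fits_def)
  qed
  have "0 + c \<in> power_exponents E n"
  proof -
    obtain u where "exponents.sol E Poly_Mapping.lookup F u b n"
      using crit by (auto simp: exponents.critical_def exponents.fits_def)
    then show ?thesis by (rule extend) auto
  qed
  moreover have "e + c \<in> power_exponents E (Suc n) \<longleftrightarrow> e \<in> meets F" for e
  proof
    assume "e + c \<in> power_exponents E (Suc n)"
    then obtain u where u: "exponents.sol E Poly_Mapping.lookup UNIV u (Poly_Mapping.lookup (e + c)) (Suc n)"
      by (auto simp: power_exponents_def exponents.fits_def)
    have "\<not> exponents.fits E Poly_Mapping.lookup F b (Suc n)"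
      using crit by (simp add: exponents.critical_def)
    then have "\<not> exponents.sol E Poly_Mapping.lookup F u b (Suc n)"
      by (auto simp: exponents.fits_def)
    then obtain i where i: "i \<in> F" "b i < (\<Sum>g\<in>E. u g * Poly_Mapping.lookup g i)"
      using u by (auto simp: exponents.sol_def not_le)
    have "(\<Sum>g\<in>E. u g * Poly_Mapping.lookup g i) \<le> Poly_Mapping.lookup (e + c) i"
      using u by (simp add: exponents.sol_def)
    then have "0 < Poly_Mapping.lookup e i" using i by (simp add: lookup_add c f_def)
    then show "e \<in> meets F" using i(1) by (auto simp: meets_def)
  next
    assume "e \<in> meets F"
    then obtain i where i: "i \<in> F" "0 < Poly_Mapping.lookup e i" by (auto simp: meets_def)
    have "exponents.fits E Poly_Mapping.lookup F (\<lambda>k. b k + of_bool (k = i)) (Suc n)"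
      using crit i(1) by (simp add: exponents.critical_def)
    then obtain u where "exponents.sol E Poly_Mapping.lookup F u (\<lambda>k. b k + of_bool (k = i)) (Suc n)"
      by (auto simp: exponents.fits_def)
    then show "e + c \<in> power_exponents E (Suc n)" by (rule extend) (use i(2) in auto)
  qed
  ultimately show "\<exists>b\<in>power_exponents E n. {e. e + b \<in> power_exponents E (Suc n)} = meets F"
    by (intro bexI[of _ c]) auto
qed

lemma associated_primes_power_iff:
  fixes P :: "('n::finite, 'k::field) mpolynomial set"
  assumes fin: "finite E" and I: "I = supported_on (multiples E)"
  shows "P \<in> associated_primes mpoly_ring
      (quotient_module (ideal_module mpoly_ring (I [^]\<^bsub>ideals_set mpoly_ring\<^esub> n))
        (I [^]\<^bsub>ideals_set mpoly_ring\<^esub> (n + 1))) \<longleftrightarrow>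
    primeideal P mpoly_ring \<and>
    (\<exists>F. P = supported_on (meets F) \<and> (\<exists>b. exponents.critical E Poly_Mapping.lookup F b n))"
  unfolding I power_supported_on[OF fin] colon_power_exponents_iff_critical[OF fin, symmetric] Suc_eq_plus1[symmetric]
  by (rule associated_primes_iff[OF upclosed_power_exponents upclosed_power_exponents
        power_exponents_decreasing[OF fin]])

section \<open>Finiteness of the minimal generators\<close>

text \<open>
  A decreasing sequence of natural numbers is eventually constant, so in either case a
  monotone subsequence yields an increasing one.
\<close>

lemma monotone_subsequence_nat:
  fixes s :: "nat \<Rightarrow> nat"
  shows "\<exists>f. strict_mono f \<and> incseq (\<lambda>n. s (f n))"
proof -
  obtain f where f: "strict_mono f" "monoseq (\<lambda>n. s (f n))" using seq_monosub[of s] by blast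
  show ?thesis
  proof (cases "incseq (\<lambda>n. s (f n))")
    case True
    then show ?thesis using f(1) by blast
  next
    case False
    then have dec: "decseq (\<lambda>n. s (f n))" using f(2) by (auto simp: monoseq_iff)
    obtain N where N: "\<And>n. s (f N) \<le> s (f n)"
      using ex_has_least_nat[of "\<lambda>_. True" 0 "\<lambda>n. s (f n)"] by blast
    have "s (f (n + N)) = s (f N)" for n
      using N[of "n + N"] decseqD[OF dec, of N "n + N"] by simp
    then have "incseq (\<lambda>n. s (f (n + N)))" by (simp add: incseq_def)
    moreover have "strict_mono (\<lambda>n. f (n + N))" using f(1) by (auto simp: strict_mono_def)
    ultimately show ?thesis by (intro exI[of _ "\<lambda>n. f (n + N)"]) simp
  qed
qed

text \<open>
  Dickson's lemma. In an infinite set, passing to subsequences one coordinate at a time gives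
  a sequence of distinct elements that increases in each coordinate.
\<close>

lemma dickson:
  fixes A :: "('n::finite \<Rightarrow>\<^sub>0 nat) set"
  assumes antichain: "\<And>e f. e \<in> A \<Longrightarrow> e + f \<in> A \<Longrightarrow> f = 0"
  shows "finite A"
proof (rule ccontr)
  assume "infinite A"
  then obtain s :: "nat \<Rightarrow> 'n \<Rightarrow>\<^sub>0 nat" where s: "inj s" "range s \<subseteq> A"
    using infinite_countable_subset by blast
  have "\<exists>f. strict_mono f \<and> (\<forall>i\<in>T. incseq (\<lambda>n. Poly_Mapping.lookup (s (f n)) i))" if "finite T" for T
    using that
  proof (induction T)
    case empty
    show ?case by (auto intro: exI[of _ id] simp: strict_mono_def)
  next
    case (insert i T)
    then obtain f where f: "strict_mono f" "\<forall>i\<in>T. incseq (\<lambda>n. Poly_Mapping.lookup (s (f n)) i)" by blast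
    obtain g where g: "strict_mono g" "incseq (\<lambda>n. Poly_Mapping.lookup (s (f (g n))) i)"
      using monotone_subsequence_nat[of "\<lambda>n. Poly_Mapping.lookup (s (f n)) i"] by blast
    have "incseq (\<lambda>n. Poly_Mapping.lookup (s (f (g n))) j)" if "j \<in> T" for j
      using f(2) that g(1) by (auto simp: incseq_def strict_mono_less_eq)
    moreover have "strict_mono (\<lambda>n. f (g n))" using f(1) g(1) by (auto simp: strict_mono_def)
    ultimately show ?case using g(2) by (intro exI[of _ "\<lambda>n. f (g n)"]) auto
  qed
  from this[of UNIV] obtain f where f: "strict_mono f"
    "\<And>i. incseq (\<lambda>n. Poly_Mapping.lookup (s (f n)) i)" by auto
  define h where "h = s (f 1) - s (f 0)"
  have "s (f 1) = s (f 0) + h"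
  proof (rule poly_mapping_eqI)
    fix i
    show "Poly_Mapping.lookup (s (f 1)) i = Poly_Mapping.lookup (s (f 0) + h) i"
      using incseqD[OF f(2)[of i], of 0 1] by (simp add: h_def lookup_add lookup_minus)
  qed
  moreover have "s (f 1) \<in> A" "s (f 0) \<in> A" using s(2) by auto
  ultimately have "h = 0" using antichain by simp
  with \<open>s (f 1) = s (f 0) + h\<close> have "f 1 = f 0" using s(1) by (simp add: inj_eq)
  then show False using strict_monoD[OF f(1), of 0 1] by simp
qed

text \<open>
  By minimality no generator divides another one, so the exponents form an antichain and
  Dickson's lemma applies. In particular the cardinality of \<open>G\<close> and the maximal degree are
  genuine and not the default values for infinite sets.
\<close>

lemma minimal_generators_exponents:
  fixes I G :: "('n::finite, 'k::field) mpolynomial set"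
  assumes G: "minimal_monomial_generators G I"
  obtains E where "finite E" "G = (\<lambda>e. Poly_Mapping.single e 1) ` E" "card G = card E"
    "I = supported_on (multiples E)"
proof -
  define x :: "('n \<Rightarrow>\<^sub>0 nat) \<Rightarrow> ('n, 'k) mpolynomial" where "x e = Poly_Mapping.single e 1" for e
  define E where "E = {e. x e \<in> G}"
  have inj: "inj x"
  proof
    fix e f assume "x e = x f"
    then have "Poly_Mapping.keys (x e) = Poly_Mapping.keys (x f)" by simp
    then show "e = f" by (simp add: x_def)
  qed
  have GE: "G = x ` E"
    using G by (auto simp: minimal_monomial_generators_def monomials_def E_def x_def)
  have gen: "Idl\<^bsub>mpoly_ring\<^esub> (x ` A) = supported_on (multiples A)" for A
    unfolding x_def by (rule genideal_monomials)
  have I: "I = supported_on (multiples E)"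
    using G gen[of E] by (simp add: minimal_monomial_generators_def GE)
  have "finite E"
  proof (rule dickson)
    fix e f assume e: "e \<in> E" and ef: "e + f \<in> E"
    show "f = 0"
    proof (rule ccontr)
      assume "f \<noteq> 0"
      then have "e \<noteq> e + f" by simp
      then have e': "e \<in> E - {e + f}" using e by simp
      have "E \<subseteq> multiples (E - {e + f})"
      proof
        fix g assume "g \<in> E"
        then show "g \<in> multiples (E - {e + f})"
          using e' subsetD[OF self_in_multiples, of g "E - {e + f}"]
          by (cases "g = e + f") (auto simp: multiples_def[of "E - {e + f}"])
      qed
      then have "multiples E \<subseteq> multiples (E - {e + f})"
        using upclosedD[OF upclosed_multiples] by (force simp: multiples_def[of E])
      moreover have "multiples (E - {e + f}) \<subseteq> multiples E" by (auto simp: multiples_def)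
      ultimately have same: "Idl\<^bsub>mpoly_ring\<^esub> (x ` (E - {e + f})) = I" unfolding gen I by simp
      have "x (e + f) \<in> G" "x (e + f) \<notin> x ` (E - {e + f})"
        unfolding GE using ef by (auto simp: inj_image_mem_iff[OF inj])
      then have "x ` (E - {e + f}) \<subset> G" unfolding GE by blast
      then show False using G same by (auto simp: minimal_monomial_generators_def)
    qed
  qed
  then show ?thesis
    using that[of E] GE I card_image[OF inj_on_subset[OF inj], of E] by (simp add: x_def[abs_def])
qed

section \<open>Numerical comparison and conclusion\<close>

lemma total_degree_monomial:
  "total_degree (Poly_Mapping.single e (1::'k::field) :: ('n::finite, 'k) mpolynomial)
    = (\<Sum>i\<in>UNIV. Poly_Mapping.lookup e i)"
  by (simp add: total_degree_def)

text \<open>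
  The powers of \<open>s\<close> in the proximity constant are absorbed by the power of \<open>2\<close> in \<open>B\<close>. From
  \<open>s = 4\<close> on this follows from \<open>s + 2 \<le> 2 ^ (s - 1)\<close>, which fails for smaller \<open>s\<close>.
\<close>

lemma two_power_dominates: "(s + 2) ^ s < 4 * s ^ 3 * 2 ^ (s\<^sup>2 - s + 1)" if "1 \<le> s" for s :: nat
proof (cases "s < 4")
  case True
  then have "s = 1 \<or> s = 2 \<or> s = 3" using that by auto
  then show ?thesis by auto
next
  case False
  then have "4 \<le> s" by simp
  then have "s + 2 \<le> 2 ^ (s - 1)"
  proof (induction s rule: nat_induct_at_least[of 4])
    case (Suc n)
    then show ?case by (cases n) auto
  qed auto
  then have "(s + 2) ^ s \<le> (2 ^ (s - 1)) ^ s" by (rule power_mono) simp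
  also have "\<dots> = 2 ^ (s\<^sup>2 - s)" by (simp add: power_mult[symmetric] power2_eq_square algebra_simps diff_mult_distrib)
  also have "\<dots> < 2 ^ (s\<^sup>2 - s + 1)" by simp
  also have "\<dots> \<le> 4 * s ^ 3 * 2 ^ (s\<^sup>2 - s + 1)" using that by simp
  finally show ?thesis .
qed

lemma proximity_below_bound:
  fixes r s d :: nat
  assumes "1 \<le> r" "1 \<le> s" "1 \<le> d"
  shows "s * ((s + r + 2) * ((s + 2) * d) ^ s) <
    s * (s + r) ^ 4 * s ^ (r + 2) * d ^ 2 * (2 * d ^ 2) ^ (s ^ 2 - s + 1)"
proof -
  define k where "k = s\<^sup>2 - s + 1"
  have "s \<le> k"
    unfolding k_def power2_eq_square using assms(2) by (cases s) (auto simp: algebra_simps)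
  then have ds: "d ^ s \<le> d ^ (2 * k)" using assms(3) by (intro power_increasing) auto
  have "((s + 2) * d) ^ s = (s + 2) ^ s * d ^ s" by (rule power_mult_distrib)
  also have "\<dots> < (4 * s ^ 3 * 2 ^ k) * d ^ (2 * k)"
    using two_power_dominates[OF assms(2)] ds assms(3) unfolding k_def
    by (intro mult_less_le_imp_less) auto
  also have "\<dots> = 4 * (s ^ 3 * (2 * d\<^sup>2) ^ k)"
    by (simp only: power_mult_distrib power_mult mult.assoc)
  finally have 1: "((s + 2) * d) ^ s < 4 * (s ^ 3 * (2 * d\<^sup>2) ^ k)" .
  have "2 ^ 3 \<le> (s + r) ^ 3" using assms by (intro power_mono) auto
  then have "8 * (s + r) \<le> (s + r) ^ 3 * (s + r)" by (intro mult_le_mono1) simp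
  moreover have "4 * (s + r + 2) \<le> 8 * (s + r)" using assms by simp
  moreover have "(s + r) ^ 3 * (s + r) = (s + r) ^ 4" by (simp add: eval_nat_numeral)
  ultimately have 2: "4 * (s + r + 2) \<le> (s + r) ^ 4" by linarith
  have "s ^ 3 \<le> s ^ (r + 2)" using assms by (intro power_increasing) auto
  then have 3: "s ^ 3 * (2 * d\<^sup>2) ^ k \<le> s ^ (r + 2) * (2 * d\<^sup>2) ^ k" by (rule mult_le_mono1)
  have "(s + r + 2) * ((s + 2) * d) ^ s < (s + r + 2) * (4 * (s ^ 3 * (2 * d\<^sup>2) ^ k))"
    using 1 by (intro mult_less_mono2) auto
  also have "\<dots> = 4 * (s + r + 2) * (s ^ 3 * (2 * d\<^sup>2) ^ k)" by (simp only: mult_ac)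
  also have "\<dots> \<le> (s + r) ^ 4 * (s ^ (r + 2) * (2 * d\<^sup>2) ^ k)" using 2 3 by (rule mult_le_mono)
  also have "\<dots> \<le> (s + r) ^ 4 * (s ^ (r + 2) * (2 * d\<^sup>2) ^ k) * d\<^sup>2" using assms(3) by simp
  finally have "s * ((s + r + 2) * ((s + 2) * d) ^ s) <
      s * ((s + r) ^ 4 * (s ^ (r + 2) * (2 * d\<^sup>2) ^ k) * d\<^sup>2)"
    using assms(2) by (intro mult_less_mono2) auto
  then show ?thesis unfolding k_def by (simp only: mult_ac)
qed

theorem theorem2p12:
  fixes I G :: "('n::finite, 'k::field) mpolynomial set"
    and r s d :: nat
    and B :: real
  assumes "monomial_ideal I" and "I \<noteq> {0}"
    and "minimal_monomial_generators G I"
    and "r = CARD('n)"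
    and "s = card G"
    and "d = Max (total_degree ` G)"
    and "B = max
      (real d * (real r * real s + real s + real d) * sqrt (real r) ^ (r + 1)
        * (sqrt 2 * real d) ^ ((r + 1) * (s - 1)))
      (real s * (real s + real r) ^ 4 * real s ^ (r + 2) * real d ^ 2
        * (2 * real d ^ 2) ^ (s ^ 2 - s + 1))"
  shows "\<forall>n :: nat. int n \<ge> \<lceil>B\<rceil> \<longrightarrow>
    associated_primes mpoly_ring
      (quotient_module
        (ideal_module mpoly_ring (I [^]\<^bsub>ideals_set mpoly_ring\<^esub> n))
        (I [^]\<^bsub>ideals_set mpoly_ring\<^esub> (n + 1))) =
    associated_primes mpoly_ring
      (quotient_module
        (ideal_module mpoly_ring (I [^]\<^bsub>ideals_set mpoly_ring\<^esub> (nat \<lceil>B\<rceil>)))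
        (I [^]\<^bsub>ideals_set mpoly_ring\<^esub> (nat \<lceil>B\<rceil> + 1)))"
proof (intro allI impI)
  fix n :: nat
  assume n: "\<lceil>B\<rceil> \<le> int n"
  obtain E where E: "finite E" "G = (\<lambda>e. Poly_Mapping.single e 1) ` E" "card G = card E"
    "I = supported_on (multiples E)"
    by (rule minimal_generators_exponents[OF assms(3)])
  have "E \<noteq> {}"
  proof
    assume "E = {}"
    then have "I = {0}" using E(4) by (auto simp: multiples_def supported_on_def)
    then show False using assms(2) by simp
  qed
  have "finite G" using E(1,2) by simp
  have degree: "Poly_Mapping.lookup g i \<le> d" if "g \<in> E" for g i
  proof -
    have "Poly_Mapping.lookup g i \<le> (\<Sum>i\<in>UNIV. Poly_Mapping.lookup g i)"
      by (intro member_le_sum) auto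
    also have "\<dots> = total_degree (Poly_Mapping.single g 1 :: ('n, 'k) mpolynomial)"
      by (simp add: total_degree_monomial)
    also have "\<dots> \<le> d" unfolding assms(6) using \<open>finite G\<close> E(2) that by (intro Max_ge) auto
    finally show ?thesis .
  qed
  have "(\<exists>b. exponents.critical E Poly_Mapping.lookup F b n) \<longleftrightarrow>
    (\<exists>b. exponents.critical E Poly_Mapping.lookup F b (nat \<lceil>B\<rceil>))" for F :: "'n set"
  proof (cases "d = 0")
    case True
    obtain g where g: "g \<in> E" using \<open>E \<noteq> {}\<close> by blast
    \<comment> \<open>All exponents vanish, so every monomial lies in every power.\<close>
    have "\<not> exponents.critical E Poly_Mapping.lookup F b m" for b m
    proof
      assume crit: "exponents.critical E Poly_Mapping.lookup F b m"
      then obtain u where "exponents.sol E Poly_Mapping.lookup F u b m"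
        by (auto simp: exponents.critical_def exponents.fits_def)
      from exponents.sol_add[OF E(1) this g]
      have "exponents.fits E Poly_Mapping.lookup F b (Suc m)"
        using degree[OF g] True by (auto simp: exponents.fits_def)
      then show False using crit by (simp add: exponents.critical_def)
    qed
    then show ?thesis by simp
  next
    case False
    then have d: "1 \<le> d" by simp
    interpret exponent_system E Poly_Mapping.lookup F d
      by unfold_locales (use E(1) d degree in auto)
    have s: "1 \<le> s" using \<open>E \<noteq> {}\<close> E(1,3) assms(5) by (simp add: Suc_le_eq card_gt_0_iff)
    have r: "1 \<le> r" using assms(4) by (simp add: Suc_le_eq)
    have "card F \<le> r" unfolding assms(4) by (intro card_mono) auto
    then have "card E * proximity \<le> s * ((s + r + 2) * ((s + 2) * d) ^ s)"
      unfolding proximity_def using E(3) assms(5) by simp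
    also have "\<dots> < s * (s + r) ^ 4 * s ^ (r + 2) * d ^ 2 * (2 * d ^ 2) ^ (s ^ 2 - s + 1)"
      by (rule proximity_below_bound[OF r s d])
    finally have "real (card E * proximity) <
      real (s * (s + r) ^ 4 * s ^ (r + 2) * d ^ 2 * (2 * d ^ 2) ^ (s ^ 2 - s + 1))"
      by (simp only: of_nat_less_iff)
    also have "\<dots> \<le> B" unfolding assms(7) by (intro max.coboundedI2) simp
    finally have "card E * proximity < nat \<lceil>B\<rceil>" by linarith
    moreover have "nat \<lceil>B\<rceil> \<le> n" using n by (simp only: nat_le_iff)
    ultimately show ?thesis by (rule critical_iff)
  qed
  then show "associated_primes mpoly_ring
      (quotient_module
        (ideal_module mpoly_ring (I [^]\<^bsub>ideals_set mpoly_ring\<^esub> n))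
        (I [^]\<^bsub>ideals_set mpoly_ring\<^esub> (n + 1))) =
    associated_primes mpoly_ring
      (quotient_module
        (ideal_module mpoly_ring (I [^]\<^bsub>ideals_set mpoly_ring\<^esub> (nat \<lceil>B\<rceil>)))
        (I [^]\<^bsub>ideals_set mpoly_ring\<^esub> (nat \<lceil>B\<rceil> + 1)))"
    by (intro equalityI subsetI) (simp_all only: associated_primes_power_iff[OF E(1,4)])
qed

end
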